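(* Consider the nonlinear Dirac system $$i(\partial_t U_1 + \partial_x U_1) = \partial_{\bar U_1} W, \qquad i(\partial_t U_2 - \partial_x U_2) = \partial_{\bar U_2} W, \qquad W = (|U_1|^2+|U_2|^2)(\bar U_1U_2+\bar U_2U_1),$$ and its self-similar solutions $$U_1(x,t) = \frac{1}{(1-t)^{1/2}}\,U\!\left(\frac{x}{1-t}\right),\qquad U_2(x,t) = \frac{1}{(1-t)^{1/2}}\,V\!\left(\frac{x}{1-t}\right),$$ that is, solutions $(U,V)$ of $$i\Big[(y+1)U'+\tfrac12 U\Big] = (|U|^2+|V|^2)V + (U\bar V+\bar U V)U,$$ $$i\Big[(y-1)V'+\tfrac12 V\Big] = (|U|^2+|V|^2)U + (U\bar V+\bar U V)V.$$ There exists a unique nonzero classical self-similar solution with $|U(0)|=|V(0)|$ that extends to $y\to 1$, and it satisfies the asymptotic behavior $$U(y)\sim(1-y)^{\frac14},\qquad V(y)\sim(1-y)^{-\frac14}\qquad\text{as } y\to1.$$ However, this solution does not extend to $y\to-1$, in the sense that there exists $y_0\in(-1,0)$ such that $\lim_{y\to y_0}U(y)$ and $\lim_{y\to y_0}V(y)$ diverge. All other nonzero classical solutions with $|U(0)|=|V(0)|$ extend neither to $y\to1$ nor to $y\to-1$.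
   Context: Here $\bar U$ denotes the complex conjugate of $U$; $\partial_{\bar U_j}W$ is the derivative of the polynomial $W$ with respect to $\bar U_j$, treating $U_1,U_2,\bar U_1,\bar U_2$ as independent variables (so $|U_j|^2=U_j\bar U_j$). The profiles $U,V$ are complex-valued functions of $y=x/(1-t)$, $t<1$, with $y$ restricted to $[-1,1]$, and the prime denotes $d/dy$. A classical solution is a $C^1$ solution $(U,V)$ of the displayed ODE system on an interval in $(-1,1)$ containing $y=0$, continued as far as possible; it extends to $y\to 1$ (respectively $y\to-1$) if it exists on all of $[0,1)$ (respectively $(-1,0]$). The symbol $\sim$ describes the power-law rate of the moduli $|U|,|V|$, up to nonzero constant factors.
   Formalization: As stated the claim fails: "unique" is proved for each r=|U(0)|=|V(0)|>0 and up to a constant common phase, and "all other solutions" excepts this whole family (all r, all phases) and also its reflections (V(-y),U(-y)), which do extend to y=-1. *)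

theory Defs
  imports "HOL-Analysis.Analysis" "HOL-Library.Landau_Symbols"
begin

text \<open>The potential as a polynomial in the independent variables \<open>u1, u2\<close> and
  \<open>w1, w2\<close>, where \<open>w1, w2\<close> stand for the conjugates of \<open>u1, u2\<close>.\<close>

definition dirac_W :: "complex \<Rightarrow> complex \<Rightarrow> complex \<Rightarrow> complex \<Rightarrow> complex" where
  "dirac_W u1 u2 w1 w2 = (u1 * w1 + u2 * w2) * (w1 * u2 + w2 * u1)"

definition dirac_system_at ::
  "(real \<Rightarrow> real \<Rightarrow> complex) \<Rightarrow> (real \<Rightarrow> real \<Rightarrow> complex) \<Rightarrow> real \<Rightarrow> real \<Rightarrow> bool" where
  "dirac_system_at U1 U2 x t \<longleftrightarrow>
     \<i> * (vector_derivative (\<lambda>t'. U1 x t') (at t) + vector_derivative (\<lambda>x'. U1 x' t) (at x))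
       = deriv (\<lambda>w. dirac_W (U1 x t) (U2 x t) w (cnj (U2 x t))) (cnj (U1 x t)) \<and>
     \<i> * (vector_derivative (\<lambda>t'. U2 x t') (at t) - vector_derivative (\<lambda>x'. U2 x' t) (at x))
       = deriv (\<lambda>w. dirac_W (U1 x t) (U2 x t) (cnj (U1 x t)) w) (cnj (U2 x t))"

definition self_similar :: "(real \<Rightarrow> complex) \<Rightarrow> real \<Rightarrow> real \<Rightarrow> complex" where
  "self_similar U x t = complex_of_real (1 / sqrt (1 - t)) * U (x / (1 - t))"

definition profile_ode_at :: "(real \<Rightarrow> complex) \<Rightarrow> (real \<Rightarrow> complex) \<Rightarrow> real \<Rightarrow> bool" where
  "profile_ode_at U V y \<longleftrightarrow>
     \<i> * (complex_of_real (y + 1) * vector_derivative U (at y) + 1 / 2 * U y)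
       = complex_of_real ((cmod (U y))\<^sup>2 + (cmod (V y))\<^sup>2) * V y
         + (U y * cnj (V y) + cnj (U y) * V y) * U y \<and>
     \<i> * (complex_of_real (y - 1) * vector_derivative V (at y) + 1 / 2 * V y)
       = complex_of_real ((cmod (U y))\<^sup>2 + (cmod (V y))\<^sup>2) * U y
         + (U y * cnj (V y) + cnj (U y) * V y) * V y"

definition classical_profile :: "real set \<Rightarrow> (real \<Rightarrow> complex) \<Rightarrow> (real \<Rightarrow> complex) \<Rightarrow> bool" where
  "classical_profile I U V \<longleftrightarrow>
     open I \<and> is_interval I \<and> 0 \<in> I \<and> I \<subseteq> {-1<..<1} \<and>
     U C1_differentiable_on I \<and> V C1_differentiable_on I \<and>
     (\<forall>y\<in>I. profile_ode_at U V y)"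

definition maximal_profile :: "real set \<Rightarrow> (real \<Rightarrow> complex) \<Rightarrow> (real \<Rightarrow> complex) \<Rightarrow> bool" where
  "maximal_profile I U V \<longleftrightarrow>
     classical_profile I U V \<and>
     (\<forall>J P Q. classical_profile J P Q \<and> I \<subseteq> J \<and> (\<forall>y\<in>I. P y = U y \<and> Q y = V y) \<longrightarrow> J = I)"

definition balanced_profile :: "real set \<Rightarrow> (real \<Rightarrow> complex) \<Rightarrow> (real \<Rightarrow> complex) \<Rightarrow> bool" where
  "balanced_profile I U V \<longleftrightarrow>
     maximal_profile I U V \<and> (\<exists>y\<in>I. U y \<noteq> 0 \<or> V y \<noteq> 0) \<and> cmod (U 0) = cmod (V 0)"

definition extends_to_plus_one :: "real set \<Rightarrow> bool" where
  "extends_to_plus_one I \<longleftrightarrow> {0..<1} \<subseteq> I"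

definition extends_to_minus_one :: "real set \<Rightarrow> bool" where
  "extends_to_minus_one I \<longleftrightarrow> {-1<..0} \<subseteq> I"

text \<open>The profile equations are invariant under \<open>(U, V) \<mapsto> (e\<^sup>i\<^sup>\<phi> U, e\<^sup>i\<^sup>\<phi> V)\<close> and
  under the reflection \<open>(U(y), V(y)) \<mapsto> (V(-y), U(-y))\<close>. Only the values on the interval of
  existence matter when profiles are compared. The common modulus \<open>r = |U(0)| = |V(0)|\<close> is a
  genuine free parameter: with \<open>1/q(y) = 1/r\<^sup>2 + 4y/sqrt(1-y\<^sup>2)\<close>, the pair
  \<open>U = sqrt(q/(1+y))\<close>, \<open>V = -i sqrt(q/(1-y))\<close> is a profile reaching \<open>y = 1\<close> for every
  \<open>r > 0\<close>. Its reflection reaches \<open>y = -1\<close>.\<close>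

definition equal_up_to_phase ::
  "real set \<Rightarrow> (real \<Rightarrow> complex) \<Rightarrow> (real \<Rightarrow> complex) \<Rightarrow>
   real set \<Rightarrow> (real \<Rightarrow> complex) \<Rightarrow> (real \<Rightarrow> complex) \<Rightarrow> bool" where
  "equal_up_to_phase J P Q I U V \<longleftrightarrow>
     J = I \<and> (\<exists>\<phi>. \<forall>y\<in>I. P y = cis \<phi> * U y \<and> Q y = cis \<phi> * V y)"

definition equal_up_to_phase_and_reflection ::
  "real set \<Rightarrow> (real \<Rightarrow> complex) \<Rightarrow> (real \<Rightarrow> complex) \<Rightarrow>
   real set \<Rightarrow> (real \<Rightarrow> complex) \<Rightarrow> (real \<Rightarrow> complex) \<Rightarrow> bool" where
  "equal_up_to_phase_and_reflection J P Q I U V \<longleftrightarrow>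
     equal_up_to_phase J P Q I U V \<or>
     equal_up_to_phase J P Q (uminus ` I) (\<lambda>y. V (- y)) (\<lambda>y. U (- y))"

lemma profile_ode_at_phase:
  assumes "U differentiable at y" "V differentiable at y" "profile_ode_at U V y"
  shows "profile_ode_at (\<lambda>y. cis \<phi> * U y) (\<lambda>y. cis \<phi> * V y) y"
proof -
  have c: "cis \<phi> * cnj (cis \<phi>) = 1"
    by (simp add: cis_cnj cis_mult)
  have c': "cis \<phi> * u * (cnj (cis \<phi>) * v) = u * v" "cnj (cis \<phi>) * u * (cis \<phi> * v) = u * v" for u v
    using c by (simp_all add: algebra_simps)
  have d: "vector_derivative (\<lambda>y. cis \<phi> * F y) (at y) = cis \<phi> * vector_derivative F (at y)"
    if "F differentiable at y" for F :: "real \<Rightarrow> complex"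
    using that by (simp add: vector_derivative_mult_at)
  have *: "\<i> * (a * (cis \<phi> * b) + 1/2 * (cis \<phi> * u)) = cis \<phi> * (\<i> * (a * b + 1/2 * u))" for a b u
    by (simp add: algebra_simps)
  show ?thesis
    using assms(3)
    unfolding profile_ode_at_def d[OF assms(1)] d[OF assms(2)] *
      norm_mult norm_cis complex_cnj_mult c' mult_1
    by (simp add: algebra_simps)
qed

lemma profile_ode_at_reflect:
  assumes "U differentiable at (- y)" "V differentiable at (- y)" "profile_ode_at U V (- y)"
  shows "profile_ode_at (\<lambda>y. V (- y)) (\<lambda>y. U (- y)) y"
proof -
  have d: "vector_derivative (\<lambda>y. F (- y)) (at y) = - vector_derivative F (at (- y))"
    if "F differentiable at (- y)" for F :: "real \<Rightarrow> complex"
  proof -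
    have "(F has_vector_derivative vector_derivative F (at (- y))) (at (- y))"
      using that vector_derivative_works by blast
    then have "((F \<circ> uminus) has_vector_derivative (-1) *\<^sub>R vector_derivative F (at (- y))) (at y)"
      by (intro vector_diff_chain_at) (auto intro!: derivative_eq_intros)
    then show ?thesis
      by (simp add: o_def vector_derivative_at)
  qed
  show ?thesis
    using assms(3) unfolding profile_ode_at_def d[OF assms(1)] d[OF assms(2)]
    by (simp add: algebra_simps)
qed

lemma dirac_system_at_self_similar_iff:
  assumes "t < 1" "U differentiable at (x / (1 - t))" "V differentiable at (x / (1 - t))"
  shows "dirac_system_at (self_similar U) (self_similar V) x t
           \<longleftrightarrow> profile_ode_at U V (x / (1 - t))"
proof -
  define y where "y = x / (1 - t)"
  define s where "s = 1 / sqrt (1 - t)"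
  have s: "s > 0" and s2: "1 / (1 - t) = s\<^sup>2"
    using assms(1) by (simp_all add: s_def power_divide)
  have y: "y = x * s\<^sup>2"
    using s2 by (simp add: y_def divide_inverse)
  have dt: "vector_derivative (\<lambda>t'. self_similar F x t') (at t)
              = of_real (s ^ 3) * (1/2 * F y + of_real y * vector_derivative F (at y))"
    and dx: "vector_derivative (\<lambda>x'. self_similar F x' t) (at x)
              = of_real (s ^ 3) * vector_derivative F (at y)"
    if F: "F differentiable at y" for F
  proof -
    have F': "(F has_vector_derivative vector_derivative F (at y)) (at y)"
      using F vector_derivative_works by blast
    have "((\<lambda>t'. x / (1 - t')) has_real_derivative y * s\<^sup>2) (at t)"
      using assms(1) unfolding y_def s2[symmetric]
      by (auto intro!: derivative_eq_intros simp: divide_simps)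
    then have "((\<lambda>t'. x / (1 - t')) has_vector_derivative y * s\<^sup>2) (at t)"
      by (simp add: has_real_derivative_iff_has_vector_derivative)
    from vector_diff_chain_at[OF this, of F] F'
    have 1: "((\<lambda>t'. F (x / (1 - t'))) has_vector_derivative
               (y * s\<^sup>2) *\<^sub>R vector_derivative F (at y)) (at t)"
      by (simp add: o_def y_def)
    have "((\<lambda>t'. 1 / sqrt (1 - t')) has_real_derivative s ^ 3 / 2) (at t)"
      using assms(1)
      by (auto intro!: derivative_eq_intros simp: s_def power3_eq_cube divide_simps)
    then have 2: "((\<lambda>t'. complex_of_real (1 / sqrt (1 - t'))) has_vector_derivative
        of_real (s ^ 3 / 2)) (at t)"
      by (simp only: has_real_derivative_iff_has_vector_derivative has_vector_derivative_of_real)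
    from has_vector_derivative_mult[OF 2 1]
    have "((\<lambda>t'. self_similar F x t') has_vector_derivative
        of_real s * ((y * s\<^sup>2) *\<^sub>R vector_derivative F (at y)) + of_real (s ^ 3 / 2) * F y) (at t)"
      by (simp add: self_similar_def s_def y_def)
    moreover have "of_real s * ((y * s\<^sup>2) *\<^sub>R vector_derivative F (at y)) + of_real (s ^ 3 / 2) * F y
        = of_real (s ^ 3) * (1/2 * F y + of_real y * vector_derivative F (at y))"
      by (simp add: scaleR_conv_of_real algebra_simps power2_eq_square power3_eq_cube)
    ultimately show "vector_derivative (\<lambda>t'. self_similar F x t') (at t)
              = of_real (s ^ 3) * (1/2 * F y + of_real y * vector_derivative F (at y))"
      by (metis vector_derivative_at)
    have "((\<lambda>x'. x' / (1 - t)) has_real_derivative s\<^sup>2) (at x)"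
      using assms(1) by (auto intro!: derivative_eq_intros simp: s2[symmetric])
    then have "((\<lambda>x'. x' / (1 - t)) has_vector_derivative s\<^sup>2) (at x)"
      by (simp add: has_real_derivative_iff_has_vector_derivative)
    from vector_diff_chain_at[OF this, of F] F'
    have "((\<lambda>x'. F (x' / (1 - t))) has_vector_derivative s\<^sup>2 *\<^sub>R vector_derivative F (at y)) (at x)"
      by (simp add: o_def y_def)
    from has_vector_derivative_mult_right[OF this, of "of_real s"]
    have "((\<lambda>x'. self_similar F x' t) has_vector_derivative
        of_real (s ^ 3) * vector_derivative F (at y)) (at x)"
      by (simp add: self_similar_def s_def[symmetric] scaleR_conv_of_real
          power2_eq_square power3_eq_cube mult.assoc)
    then show "vector_derivative (\<lambda>x'. self_similar F x' t) (at x)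
              = of_real (s ^ 3) * vector_derivative F (at y)"
      by (rule vector_derivative_at)
  qed
  have W1: "deriv (\<lambda>w. dirac_W a b w d) c = a * (c * b + d * a) + (a * c + b * d) * b" for a b c d
    unfolding dirac_W_def by (rule DERIV_imp_deriv) (auto intro!: derivative_eq_intros)
  have W2: "deriv (\<lambda>w. dirac_W a b c w) d = b * (c * b + d * a) + (a * c + b * d) * a" for a b c d
    unfolding dirac_W_def by (rule DERIV_imp_deriv) (auto intro!: derivative_eq_intros)
  have ss: "self_similar F x t = of_real s * F y" for F
    by (simp add: self_similar_def s_def y_def)
  have canc: "A = B \<longleftrightarrow> C = D"
    if "A = of_real (s ^ 3) * C" "B = of_real (s ^ 3) * D" for A B C D :: complex
    using s that by simp
  have e1: "\<i> * (of_real (s ^ 3) * (1/2 * U y + of_real y * p) + of_real (s ^ 3) * p)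
              = of_real (s ^ 3) * (\<i> * (of_real (y + 1) * p + 1/2 * U y))" for p
    by (simp add: algebra_simps)
  have e2: "\<i> * (of_real (s ^ 3) * (1/2 * V y + of_real y * p) - of_real (s ^ 3) * p)
              = of_real (s ^ 3) * (\<i> * (of_real (y - 1) * p + 1/2 * V y))" for p
    by (simp add: algebra_simps)
  have U: "U differentiable at y" and V: "V differentiable at y"
    using assms by (simp_all add: y_def)
  show ?thesis
    unfolding dirac_system_at_def profile_ode_at_def y_def[symmetric] dt[OF U] dt[OF V] dx[OF U] dx[OF V]
      W1 W2 ss
    by (intro arg_cong2[where f = "(\<and>)"] canc e1 e2)
       (simp_all add: algebra_simps power3_eq_cube complex_norm_square del: of_real_power)
qed

end

theory Submission
  imports Defs
begin

text \<open>The problem reduces to an autonomous planar system. Balanced data satisfy the conservation law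
  \<open>(1 + y) |U|\<^sup>2 = (1 - y) |V|\<^sup>2\<close>; call the common value \<open>q\<close>, and put
  \<open>X + i Y = sqrt (1 - y\<^sup>2) V cnj U\<close>, a complex number of modulus \<open>q\<close>. In the time variable
  \<open>\<tau> = 4 y / sqrt (1 - y\<^sup>2)\<close>, which maps \<open>(-1, 1)\<close> onto the whole line, the profile equations
  imply \<open>X' = - X Y\<close> and \<open>Y' = 2 X\<^sup>2 + Y\<^sup>2\<close> (lemma \<open>overlap_derivs\<close>). A profile extends to
  \<open>y = 1\<close> only if its orbit exists for all positive \<open>\<tau>\<close>.

  If \<open>X(0) \<noteq> 0\<close>, the orbit blows up in finite positive time
  (lemma \<open>no_extension_if_Re_overlap_nonzero\<close>). If \<open>X(0) = 0\<close>, then \<open>X\<close> vanishes identically,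
  because \<open>q X\<close> is conserved, and \<open>Y' = Y\<^sup>2\<close> gives \<open>Y = 1 / (1 / Y(0) - \<tau>)\<close> with
  \<open>Y(0) = r\<^sup>2\<close> or \<open>Y(0) = - r\<^sup>2\<close>, where \<open>r = |U(0)|\<close>. The first choice blows up before \<open>y = 1\<close>.
  The second exists for all \<open>\<tau> > - 1 / r\<^sup>2\<close>; so it reaches \<open>y = 1\<close> and blows up at an interior point
  to the left of \<open>0\<close>. In that case \<open>V\<close> is determined by \<open>U\<close>, and \<open>U\<close> solves a linear equation,
  so the profile is an explicit one up to a constant phase
  (lemma \<open>negative_overlap_equal_up_to_phase\<close>); the rates at \<open>y = 1\<close> are read off the formula.

  The reflection \<open>(U(y), V(y)) \<mapsto> (V(-y), U(-y))\<close> turns extension to \<open>y = -1\<close> into extension to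
  \<open>y = 1\<close>, so a profile that reaches either end is, up to phase, the explicit one or its
  reflection.\<close>

section \<open>A uniqueness lemma and the time variable\<close>

text \<open>An integrating factor makes \<open>g\<close> times an exponential constant. Applied to
  the mass, it shows that a nonzero profile does not vanish at \<open>0\<close>; applied to a defect, it
  verifies the formula that solves the Riccati equation.\<close>

lemma linear_ode_zero:
  fixes g c :: "real \<Rightarrow> real"
  assumes J: "is_interval J" "a \<in> J" "y \<in> J"
    and c: "continuous_on J c"
    and g: "\<And>t. t \<in> J \<Longrightarrow> (g has_real_derivative c t * g t) (at t)"
    and g0: "g a = 0"
  shows "g y = 0"
proof -
  define l u where "l = min a y" and "u = max a y"
  have lu: "{l..u} \<subseteq> J"
    using mem_is_interval_1_I[OF J] mem_is_interval_1_I[OF J(1) J(3) J(2)]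
    by (cases "a \<le> y") (auto simp: l_def u_def)
  define C where "C t = integral {l..t} c" for t
  have C: "(C has_real_derivative c t) (at t within {l..u})" if "t \<in> {l..u}" for t
    unfolding C_def
    using that c lu by (intro integral_has_real_derivative) (auto intro: continuous_on_subset)
  have "((\<lambda>t. g t * exp (- C t)) has_real_derivative 0) (at t within {l..u})"
    if t: "t \<in> {l..u}" for t
  proof -
    have "((\<lambda>t. exp (- C t)) has_real_derivative exp (- C t) * - c t) (at t within {l..u})"
      by (rule DERIV_chain2[OF DERIV_exp DERIV_minus[OF C[OF t]]])
    from DERIV_mult[OF has_field_derivative_at_within[OF g[OF subsetD[OF lu t]]] this]
    show ?thesis by (simp add: algebra_simps)
  qed
  then obtain k where k: "g t * exp (- C t) = k" if "t \<in> {l..u}" for t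
    using has_field_derivative_zero_constant[OF convex_real_interval(5), of l u "\<lambda>t. g t * exp (- C t)"]
    by blast
  have "k = 0"
    using k[of a] g0 by (simp add: l_def u_def)
  then show ?thesis
    using k[of y] by (simp add: l_def u_def)
qed

text \<open>The time \<open>\<tau>\<close> in which the equations for the overlap become autonomous. It maps
  \<open>(-1, 1)\<close> increasingly onto the whole line, so reaching \<open>y = 1\<close> means existence for all
  \<open>\<tau> \<ge> 0\<close>.\<close>

definition clock :: "real \<Rightarrow> real" where
  "clock y = 4 * y / sqrt (1 - y\<^sup>2)"

lemma one_minus_square_pos: "0 < 1 - y\<^sup>2" if "y \<in> {-1<..<1}" for y :: real
  using that by (simp add: abs_square_less_1 abs_less_iff)

lemma clock_deriv:
  assumes "y \<in> {-1<..<1}"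
  shows "(clock has_real_derivative 4 / sqrt (1 - y\<^sup>2) ^ 3) (at y)"
proof -
  define S where "S = sqrt (1 - y\<^sup>2)"
  have S: "S > 0" "S\<^sup>2 = 1 - y\<^sup>2"
    using one_minus_square_pos[OF assms] by (simp_all add: S_def)
  have eq: "4 / S ^ 3 = (4 * S - 4 * y * (- y / S)) / (S * S)"
  proof -
    have "(4 * S - 4 * y * (- y / S)) / (S * S) = 4 * (S\<^sup>2 + y\<^sup>2) / S ^ 3"
      using S(1) by (simp add: field_simps power2_eq_square power3_eq_cube)
    then show ?thesis by (simp add: S)
  qed
  have s: "((\<lambda>y. sqrt (1 - y\<^sup>2)) has_real_derivative - y / S) (at y)"
    using one_minus_square_pos[OF assms] unfolding S_def
    by (auto intro!: derivative_eq_intros simp: divide_simps)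
  have "((\<lambda>y. 4 * y / sqrt (1 - y\<^sup>2)) has_real_derivative
      (4 * S - 4 * y * (- y / S)) / (S * S)) (at y)"
    using S(1) unfolding S_def[symmetric]
    by (intro DERIV_divide[where f = "\<lambda>y. 4 * y" and g = "\<lambda>y. sqrt (1 - y\<^sup>2)" and x = y, folded S_def] s)
       (auto intro!: derivative_eq_intros)
  then show ?thesis
    unfolding clock_def S_def[symmetric] eq .
qed

lemma clock_eq: "clock (T / sqrt (16 + T\<^sup>2)) = T" "T / sqrt (16 + T\<^sup>2) \<in> {-1<..<1}"
proof -
  have p: "16 + T\<^sup>2 > 0" by (smt (verit) zero_le_power2)
  have "1 - (T / sqrt (16 + T\<^sup>2))\<^sup>2 = 16 / (16 + T\<^sup>2)"
    using p by (simp add: power_divide field_simps)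
  then show "clock (T / sqrt (16 + T\<^sup>2)) = T"
    using p by (simp add: clock_def real_sqrt_divide)
  have "\<bar>T\<bar> < sqrt (16 + T\<^sup>2)"
    by (rule real_less_rsqrt) simp
  then show "T / sqrt (16 + T\<^sup>2) \<in> {-1<..<1}"
    using p by (auto simp: field_simps)
qed

lemma clock_strict_mono: "clock x < clock y" if "-1 < x" "x < y" "y < 1"
proof (rule DERIV_pos_imp_increasing_open[OF that(2)])
  fix t assume t: "x < t" "t < y"
  then have "t \<in> {-1<..<1}" using that by auto
  then show "\<exists>d. (clock has_real_derivative d) (at t) \<and> 0 < d"
    using clock_deriv one_minus_square_pos by (intro exI[of _ "4 / sqrt (1 - t\<^sup>2) ^ 3"]) auto
next
  show "continuous_on {x..y} clock"
    using that by (intro continuous_at_imp_continuous_on ballI DERIV_isCont[OF clock_deriv]) auto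
qed

section \<open>Reduction to a planar system\<close>

lemma profile_odeD:
  assumes "classical_profile I U V" "y \<in> I"
  shows "(U has_vector_derivative
      (- (U y / 2) - \<i> * (of_real ((cmod (U y))\<^sup>2 + (cmod (V y))\<^sup>2) * V y
         + (U y * cnj (V y) + cnj (U y) * V y) * U y)) / of_real (1 + y)) (at y)" (is ?A)
    and "(V has_vector_derivative
      (V y / 2 + \<i> * (of_real ((cmod (U y))\<^sup>2 + (cmod (V y))\<^sup>2) * U y
         + (U y * cnj (V y) + cnj (U y) * V y) * V y)) / of_real (1 - y)) (at y)" (is ?B)
proof -
  define u v where "u = vector_derivative U (at y)" and "v = vector_derivative V (at y)"
  have d: "(U has_vector_derivative u) (at y)" "(V has_vector_derivative v) (at y)"
    using assms unfolding classical_profile_def C1_differentiable_on_def u_def v_def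
    by (metis vector_derivative_at)+
  have y: "complex_of_real (1 + y) \<noteq> 0" "complex_of_real (1 - y) \<noteq> 0"
    using assms unfolding classical_profile_def of_real_eq_0_iff by auto
  have swap: "x = - (\<i> * b) - c" if "\<i> * (x + c) = b" for x b c :: complex
    unfolding that[symmetric] by (simp flip: mult.assoc)
  have ode: "profile_ode_at U V y"
    using assms by (auto simp: classical_profile_def)
  have u: "of_real (y + 1) * u = - (\<i> * (of_real ((cmod (U y))\<^sup>2 + (cmod (V y))\<^sup>2) * V y
         + (U y * cnj (V y) + cnj (U y) * V y) * U y)) - 1 / 2 * U y"
    using ode unfolding profile_ode_at_def u_def by (intro swap) auto
  have v: "of_real (y - 1) * v = - (\<i> * (of_real ((cmod (U y))\<^sup>2 + (cmod (V y))\<^sup>2) * U y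
         + (U y * cnj (V y) + cnj (U y) * V y) * V y)) - 1 / 2 * V y"
    using ode unfolding profile_ode_at_def v_def by (intro swap) auto
  have "u * of_real (1 + y) = of_real (y + 1) * u" "v * of_real (1 - y) = - (of_real (y - 1) * v)"
    by (simp_all add: algebra_simps)
  note uv = this[unfolded u v]
  show ?A
    by (rule has_vector_derivative_eq_rhs[OF d(1)], rule nonzero_eq_divide_eq[OF y(1), THEN iffD2],
        subst uv(1)) simp
  show ?B
    by (rule has_vector_derivative_eq_rhs[OF d(2)], rule nonzero_eq_divide_eq[OF y(2), THEN iffD2],
        subst uv(2)) simp
qed

text \<open>The sesquilinear quantities below are combinations of real and imaginary parts, so
  their derivatives reduce to polynomial identities once the system is written in four real
  unknowns.\<close>

lemma Re_Im_ode:
  assumes "classical_profile I U V" "y \<in> I"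
  defines "u1 \<equiv> Re (U y)" and "u2 \<equiv> Im (U y)" and "v1 \<equiv> Re (V y)" and "v2 \<equiv> Im (V y)"
  defines "n \<equiv> u1\<^sup>2 + u2\<^sup>2 + v1\<^sup>2 + v2\<^sup>2" and "p \<equiv> 2 * (u1 * v1 + u2 * v2)"
  shows "((\<lambda>y. Re (U y)) has_real_derivative (- u1 / 2 + n * v2 + p * u2) / (1 + y)) (at y)"
    and "((\<lambda>y. Im (U y)) has_real_derivative (- u2 / 2 - n * v1 - p * u1) / (1 + y)) (at y)"
    and "((\<lambda>y. Re (V y)) has_real_derivative (v1 / 2 - n * u2 - p * v2) / (1 - y)) (at y)"
    and "((\<lambda>y. Im (V y)) has_real_derivative (v2 / 2 + n * u1 + p * v1) / (1 - y)) (at y)"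
proof -
  have p: "U y * cnj (V y) + cnj (U y) * V y = of_real p"
    by (simp add: complex_eq_iff p_def u1_def u2_def v1_def v2_def)
  have n: "(cmod (U y))\<^sup>2 + (cmod (V y))\<^sup>2 = n"
    by (simp add: cmod_power2 n_def u1_def u2_def v1_def v2_def)
  note d = profile_odeD[OF assms(1,2), unfolded p n]
  note r = bounded_linear.has_vector_derivative[OF bounded_linear_Re]
    bounded_linear.has_vector_derivative[OF bounded_linear_Im]
  show "((\<lambda>y. Re (U y)) has_real_derivative (- u1 / 2 + n * v2 + p * u2) / (1 + y)) (at y)"
    "((\<lambda>y. Im (U y)) has_real_derivative (- u2 / 2 - n * v1 - p * u1) / (1 + y)) (at y)"
    unfolding has_real_derivative_iff_has_vector_derivative
    by (rule has_vector_derivative_eq_rhs, rule r, rule d,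
        simp only: Re_divide_of_real Im_divide_of_real, simp add: u1_def u2_def v1_def v2_def)+
  show "((\<lambda>y. Re (V y)) has_real_derivative (v1 / 2 - n * u2 - p * v2) / (1 - y)) (at y)"
    "((\<lambda>y. Im (V y)) has_real_derivative (v2 / 2 + n * u1 + p * v1) / (1 - y)) (at y)"
    unfolding has_real_derivative_iff_has_vector_derivative
    by (rule has_vector_derivative_eq_rhs, rule r, rule d,
        simp only: Re_divide_of_real Im_divide_of_real, simp add: u1_def u2_def v1_def v2_def)+
qed

lemma bilinear_derivs:
  assumes "classical_profile I U V" "y \<in> I"
  defines "n \<equiv> (cmod (U y))\<^sup>2 + (cmod (V y))\<^sup>2"
    and "M \<equiv> Re (V y * cnj (U y))" and "N \<equiv> Im (V y * cnj (U y))"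
  shows "((\<lambda>y. (cmod (U y))\<^sup>2) has_real_derivative (- (cmod (U y))\<^sup>2 + 2 * n * N) / (1 + y)) (at y)"
    and "((\<lambda>y. (cmod (V y))\<^sup>2) has_real_derivative ((cmod (V y))\<^sup>2 + 2 * n * N) / (1 - y)) (at y)"
    and "((\<lambda>y. Re (V y * cnj (U y))) has_real_derivative (y * M - 4 * M * N) / (1 - y\<^sup>2)) (at y)"
    and "((\<lambda>y. Im (V y * cnj (U y))) has_real_derivative
           (y * N + 4 * M\<^sup>2) / (1 - y\<^sup>2)
             + n * ((cmod (U y))\<^sup>2 / (1 - y) + (cmod (V y))\<^sup>2 / (1 + y))) (at y)"
proof -
  define u1 u2 v1 v2 where "u1 = Re (U y)" and "u2 = Im (U y)" and "v1 = Re (V y)" and "v2 = Im (V y)"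
  note uv = u1_def[symmetric] u2_def[symmetric] v1_def[symmetric] v2_def[symmetric]
  define a b where "a = u1\<^sup>2 + u2\<^sup>2" and "b = v1\<^sup>2 + v2\<^sup>2"
  define r1 r2 r3 r4 where "r1 = - u1 / 2 + n * v2 + 2 * M * u2" and "r2 = - u2 / 2 - n * v1 - 2 * M * u1"
    and "r3 = v1 / 2 - n * u2 - 2 * M * v2" and "r4 = v2 / 2 + n * u1 + 2 * M * v1"
  have ab: "(cmod (U y))\<^sup>2 = a" "(cmod (V y))\<^sup>2 = b"
    by (simp_all add: cmod_power2 a_def b_def uv)
  have M: "M = u1 * v1 + u2 * v2" and N: "N = v2 * u1 - v1 * u2"
    by (simp_all add: M_def N_def uv)
  have n: "u1\<^sup>2 + u2\<^sup>2 + v1\<^sup>2 + v2\<^sup>2 = n"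
    by (simp add: n_def ab a_def b_def)
  note d = Re_Im_ode[OF assms(1,2), unfolded uv n M[symmetric], folded r1_def r2_def r3_def r4_def]
  have y: "1 + y \<noteq> 0" "1 - y \<noteq> 0" and y2: "1 - y\<^sup>2 = (1 + y) * (1 - y)"
    using assms by (auto simp: classical_profile_def power2_eq_square algebra_simps)
  have e1: "u1 * r1 + u2 * r2 = - a / 2 + n * N" "v1 * r3 + v2 * r4 = b / 2 + n * N"
    unfolding r1_def r2_def r3_def r4_def N a_def b_def by algebra+
  have e2: "v1 * r1 + v2 * r2 = - M / 2 - 2 * M * N" "u1 * r3 + u2 * r4 = M / 2 - 2 * M * N"
    unfolding r1_def r2_def r3_def r4_def N M by algebra+
  have e3: "v2 * r1 - v1 * r2 = - N / 2 + n * b + 2 * M\<^sup>2" "u1 * r4 - u2 * r3 = N / 2 + n * a + 2 * M\<^sup>2"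
    unfolding r1_def r2_def r3_def r4_def N M a_def b_def by algebra+
  have "((\<lambda>y. (Re (U y))\<^sup>2 + (Im (U y))\<^sup>2) has_real_derivative
      2 * (u1 * r1 + u2 * r2) / (1 + y)) (at y)"
    by (rule derivative_eq_intros refl d)+ (simp add: uv add_divide_distrib algebra_simps)
  then show "((\<lambda>y. (cmod (U y))\<^sup>2) has_real_derivative
      (- (cmod (U y))\<^sup>2 + 2 * n * N) / (1 + y)) (at y)"
    unfolding e1 ab by (simp add: cmod_power2 algebra_simps)
  have "((\<lambda>y. (Re (V y))\<^sup>2 + (Im (V y))\<^sup>2) has_real_derivative
      2 * (v1 * r3 + v2 * r4) / (1 - y)) (at y)"
    by (rule derivative_eq_intros refl d)+ (simp add: uv add_divide_distrib algebra_simps)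
  then show "((\<lambda>y. (cmod (V y))\<^sup>2) has_real_derivative
      ((cmod (V y))\<^sup>2 + 2 * n * N) / (1 - y)) (at y)"
    unfolding e1 ab by (simp add: cmod_power2 algebra_simps)
  have "((\<lambda>y. Re (V y) * Re (U y) + Im (V y) * Im (U y)) has_real_derivative
      (v1 * r1 + v2 * r2) / (1 + y) + (u1 * r3 + u2 * r4) / (1 - y)) (at y)"
    by (rule derivative_eq_intros refl d)+ (simp add: uv add_divide_distrib algebra_simps)
  moreover have "(- M / 2 - 2 * M * N) / (1 + y) + (M / 2 - 2 * M * N) / (1 - y)
      = (y * M - 4 * M * N) / (1 - y\<^sup>2)"
    using y unfolding y2 by (simp add: divide_simps; simp add: algebra_simps)
  ultimately show "((\<lambda>y. Re (V y * cnj (U y))) has_real_derivative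
      (y * M - 4 * M * N) / (1 - y\<^sup>2)) (at y)"
    unfolding e2 by simp
  have "((\<lambda>y. Im (V y) * Re (U y) - Re (V y) * Im (U y)) has_real_derivative
      (v2 * r1 - v1 * r2) / (1 + y) + (u1 * r4 - u2 * r3) / (1 - y)) (at y)"
    by (rule derivative_eq_intros refl d)+ (simp add: uv add_divide_distrib diff_divide_distrib algebra_simps)
  moreover have "(- N / 2 + n * b + 2 * M\<^sup>2) / (1 + y) + (N / 2 + n * a + 2 * M\<^sup>2) / (1 - y)
      = (y * N + 4 * M\<^sup>2) / (1 - y\<^sup>2) + n * (a / (1 - y) + b / (1 + y))"
    using y unfolding y2 by (simp add: divide_simps; simp add: algebra_simps)
  ultimately show "((\<lambda>y. Im (V y * cnj (U y))) has_real_derivative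
           (y * N + 4 * M\<^sup>2) / (1 - y\<^sup>2)
             + n * ((cmod (U y))\<^sup>2 / (1 - y) + (cmod (V y))\<^sup>2 / (1 + y))) (at y)"
    unfolding e3 ab by simp
qed

text \<open>For balanced data this is also \<open>(1 - y) |V|\<^sup>2\<close>, see \<open>mass_balance\<close>.\<close>

definition mass :: "(real \<Rightarrow> complex) \<Rightarrow> real \<Rightarrow> real" where
  "mass U y = (1 + y) * (cmod (U y))\<^sup>2"

text \<open>The factor \<open>sqrt (1 - y\<^sup>2)\<close> removes the linear damping terms: it cancels the factors
  \<open>(1 + y) powr (- 1 / 2)\<close> and \<open>(1 - y) powr (- 1 / 2)\<close> that the terms \<open>U / 2\<close> and \<open>V / 2\<close> force on the
  moduli. Up to a real factor the real part is the term \<open>U cnj V + cnj U V\<close> of the profile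
  equations.\<close>

definition overlap :: "(real \<Rightarrow> complex) \<Rightarrow> (real \<Rightarrow> complex) \<Rightarrow> real \<Rightarrow> complex" where
  "overlap U V y = complex_of_real (sqrt (1 - y\<^sup>2)) * (V y * cnj (U y))"

lemma constant_on_interval:
  fixes f :: "real \<Rightarrow> real"
  assumes "is_interval I" "a \<in> I" "y \<in> I" "\<And>t. t \<in> I \<Longrightarrow> (f has_real_derivative 0) (at t)"
  shows "f y = f a"
  using has_field_derivative_zero_constant[of I f] assms is_interval_convex
  by (metis has_field_derivative_at_within)

lemma classical_profile_interval:
  assumes "classical_profile I U V"
  shows "is_interval I" "0 \<in> I" "\<And>y. y \<in> I \<Longrightarrow> y \<in> {-1<..<1}"
  using assms by (auto simp: classical_profile_def)

text \<open>Both \<open>(1 + y) |U|\<^sup>2\<close> and \<open>(1 - y) |V|\<^sup>2\<close> change at the rate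
  \<open>2 (|U|\<^sup>2 + |V|\<^sup>2) Im (V cnj U)\<close>, so their difference keeps its value at \<open>y = 0\<close>, which is zero
  for balanced data.\<close>

lemma mass_balance:
  assumes cp: "classical_profile I U V" and bal: "cmod (U 0) = cmod (V 0)" and y: "y \<in> I"
  shows "(1 - y) * (cmod (V y))\<^sup>2 = mass U y"
proof -
  let ?f = "\<lambda>y. (1 + y) * (cmod (U y))\<^sup>2 - (1 - y) * (cmod (V y))\<^sup>2"
  note I = classical_profile_interval[OF cp]
  have "?f y = ?f 0"
  proof (rule constant_on_interval[OF I(1,2) y])
    fix t assume t: "t \<in> I"
    note [derivative_intros] = bilinear_derivs(1,2)[OF cp t]
    show "(?f has_real_derivative 0) (at t)"
      using I(3)[OF t] by (auto intro!: derivative_eq_intros)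
  qed
  then show ?thesis
    using bal by (simp add: mass_def)
qed

lemma overlap_norm:
  assumes cp: "classical_profile I U V" and bal: "cmod (U 0) = cmod (V 0)" and y: "y \<in> I"
  shows "cmod (overlap U V y) = mass U y"
proof -
  have y': "0 < 1 + y" "0 < 1 - y"
    using classical_profile_interval(3)[OF cp y] by auto
  have s: "1 - y\<^sup>2 = (1 + y) * (1 - y)"
    by (simp add: power2_eq_square algebra_simps)
  have "(cmod (overlap U V y))\<^sup>2 = ((1 + y) * (cmod (U y))\<^sup>2) * ((1 - y) * (cmod (V y))\<^sup>2)"
    using y' by (simp add: overlap_def norm_mult power_mult_distrib s)
  also have "\<dots> = (mass U y)\<^sup>2"
    unfolding mass_balance[OF cp bal y] by (simp add: mass_def power2_eq_square)
  finally show ?thesis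
    using y' by (subst (asm) power2_eq_iff_nonneg) (auto simp: mass_def)
qed

text \<open>Dividing by \<open>w = d\<tau>/dy\<close> gives the autonomous planar system
  \<open>X' = - X Y\<close>, \<open>Y' = 2 X\<^sup>2 + Y\<^sup>2\<close>, with \<open>q' = q Y\<close> for \<open>q = |X + i Y|\<close>. The quantity \<open>q X\<close> is
  conserved, and on the invariant line \<open>X = 0\<close> the system is the Riccati equation
  \<open>Y' = Y\<^sup>2\<close>.\<close>

lemma overlap_derivs:
  assumes cp: "classical_profile I U V" and bal: "cmod (U 0) = cmod (V 0)" and y: "y \<in> I"
  defines "w \<equiv> 4 / sqrt (1 - y\<^sup>2) ^ 3"
    and "X \<equiv> Re (overlap U V y)" and "Y \<equiv> Im (overlap U V y)"
  shows "((\<lambda>y. Re (overlap U V y)) has_real_derivative - (w * X * Y)) (at y)"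
    and "((\<lambda>y. Im (overlap U V y)) has_real_derivative w * (2 * X\<^sup>2 + Y\<^sup>2)) (at y)"
    and "(mass U has_real_derivative w * mass U y * Y) (at y)"
proof -
  define S where "S = sqrt (1 - y\<^sup>2)"
  define M N where "M = Re (V y * cnj (U y))" and "N = Im (V y * cnj (U y))"
  define n where "n = (cmod (U y))\<^sup>2 + (cmod (V y))\<^sup>2"
  define q where "q = mass U y"
  have y': "y \<in> {-1<..<1}"
    using classical_profile_interval(3)[OF cp y] .
  then have y1: "1 + y > 0" "1 - y > 0" by auto
  have S: "S > 0" "S\<^sup>2 = 1 - y\<^sup>2"
    using one_minus_square_pos[OF y'] by (simp_all add: S_def)
  have S2: "S\<^sup>2 = (1 + y) * (1 - y)"
    using S by (simp add: power2_eq_square algebra_simps)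
  have X: "X = S * M" and Y: "Y = S * N"
    by (simp_all add: X_def Y_def M_def N_def overlap_def S_def)
  have a: "(cmod (U y))\<^sup>2 = q / (1 + y)" and b: "(cmod (V y))\<^sup>2 = q / (1 - y)"
    using y1 mass_balance[OF cp bal y] by (auto simp: q_def mass_def field_simps)
  have n: "n = 2 * q / S\<^sup>2"
    unfolding n_def a b S2 using y1 by (simp add: divide_simps; simp add: algebra_simps)
  have q2: "q\<^sup>2 = X\<^sup>2 + Y\<^sup>2"
    using overlap_norm[OF cp bal y] by (simp add: q_def X_def Y_def cmod_power2 flip: cmod_power2)
  have s: "((\<lambda>y. sqrt (1 - y\<^sup>2)) has_real_derivative - y / S) (at y)"
    using one_minus_square_pos[OF y'] unfolding S_def
    by (auto intro!: derivative_eq_intros simp: divide_simps)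
  note d = bilinear_derivs[OF cp y, folded n_def M_def N_def S(2)]
  have w: "w = 4 / S ^ 3"
    by (simp add: w_def S_def)
  have "((\<lambda>y. sqrt (1 - y\<^sup>2) * Re (V y * cnj (U y))) has_real_derivative
      - y / S * M + (y * M - 4 * M * N) / S\<^sup>2 * S) (at y)"
    using DERIV_mult[OF s d(3)] unfolding S_def[symmetric] M_def[symmetric] .
  moreover have "- y / S * M + (y * M - 4 * M * N) / S\<^sup>2 * S = - (w * X * Y)"
    using S(1) by (simp add: X Y w divide_simps power2_eq_square power3_eq_cube; simp add: algebra_simps)
  ultimately show "((\<lambda>y. Re (overlap U V y)) has_real_derivative - (w * X * Y)) (at y)"
    by (simp add: overlap_def)
  have "((\<lambda>y. sqrt (1 - y\<^sup>2) * Im (V y * cnj (U y))) has_real_derivative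
      - y / S * N + ((y * N + 4 * M\<^sup>2) / S\<^sup>2
             + n * ((cmod (U y))\<^sup>2 / (1 - y) + (cmod (V y))\<^sup>2 / (1 + y))) * S) (at y)"
    using DERIV_mult[OF s d(4)] unfolding S_def[symmetric] N_def[symmetric] .
  moreover have "(cmod (U y))\<^sup>2 / (1 - y) + (cmod (V y))\<^sup>2 / (1 + y) = 2 * q / S\<^sup>2"
    unfolding a b S2 using y1 by (simp add: divide_simps; simp add: algebra_simps)
  moreover have "- y / S * N + ((y * N + 4 * M\<^sup>2) / S\<^sup>2 + n * (2 * q / S\<^sup>2)) * S
      = w * (2 * X\<^sup>2 + Y\<^sup>2)"
  proof -
    have "- y / S * N + ((y * N + 4 * M\<^sup>2) / S\<^sup>2 + n * (2 * q / S\<^sup>2)) * S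
        = 4 * M\<^sup>2 / S + 4 * q\<^sup>2 / S ^ 3"
      unfolding n using S(1) by (simp add: divide_simps power2_eq_square power3_eq_cube; simp add: algebra_simps)
    also have "\<dots> = w * (2 * X\<^sup>2 + Y\<^sup>2)"
      unfolding q2 w X Y using S(1) by (simp add: divide_simps power2_eq_square power3_eq_cube; simp add: algebra_simps)
    finally show ?thesis .
  qed
  ultimately show "((\<lambda>y. Im (overlap U V y)) has_real_derivative w * (2 * X\<^sup>2 + Y\<^sup>2)) (at y)"
    by (simp add: overlap_def)
  have "((\<lambda>y. (1 + y) * (cmod (U y))\<^sup>2) has_real_derivative
       (cmod (U y))\<^sup>2 + (- (cmod (U y))\<^sup>2 + 2 * n * N) / (1 + y) * (1 + y)) (at y)"
    by (rule derivative_eq_intros refl d(1))+ simp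
  moreover have "(cmod (U y))\<^sup>2 + (- (cmod (U y))\<^sup>2 + 2 * n * N) / (1 + y) * (1 + y) = w * q * Y"
    using S(1) y1 by (simp add: n Y w divide_simps power2_eq_square power3_eq_cube)
  ultimately show "(mass U has_real_derivative w * mass U y * Y) (at y)"
    by (simp add: mass_def[abs_def] q_def)
qed

section \<open>Dynamics of the overlap\<close>

lemma coeff_continuous:
  assumes cp: "classical_profile I U V" and bal: "cmod (U 0) = cmod (V 0)"
  shows "continuous_on I (\<lambda>y. 4 / sqrt (1 - y\<^sup>2) ^ 3 * Im (overlap U V y))"
proof -
  have "continuous_on I (\<lambda>y. Im (overlap U V y))"
    by (intro continuous_at_imp_continuous_on ballI DERIV_isCont[OF overlap_derivs(2)[OF cp bal]])
  moreover have "\<forall>y\<in>I. sqrt (1 - y\<^sup>2) ^ 3 \<noteq> 0"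
    using classical_profile_interval(3)[OF cp] one_minus_square_pos by force
  then have "continuous_on I (\<lambda>y. 4 / sqrt (1 - y\<^sup>2) ^ 3)"
    by (intro continuous_intros) auto
  ultimately show ?thesis
    by (rule continuous_on_mult[rotated])
qed

text \<open>The mass solves a linear homogeneous equation, so if it vanished at \<open>0\<close> it would vanish
  everywhere, and the profile with it.\<close>

lemma balanced_profile_nonzero:
  assumes "balanced_profile I U V"
  shows "U 0 \<noteq> 0"
proof
  assume U0: "U 0 = 0"
  have cp: "classical_profile I U V" and bal: "cmod (U 0) = cmod (V 0)"
    using assms by (auto simp: balanced_profile_def maximal_profile_def)
  obtain y where y: "y \<in> I" "U y \<noteq> 0 \<or> V y \<noteq> 0"
    using assms by (auto simp: balanced_profile_def)
  note I = classical_profile_interval[OF cp]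
  have "mass U y = 0"
  proof (rule linear_ode_zero[OF I(1,2) y(1) coeff_continuous[OF cp bal]])
    show "(mass U has_real_derivative
        4 / sqrt (1 - t\<^sup>2) ^ 3 * Im (overlap U V t) * mass U t) (at t)" if "t \<in> I" for t
      using overlap_derivs(3)[OF cp bal that] by (simp add: mult_ac)
  qed (simp add: mass_def U0)
  moreover have "(1 - y) * (cmod (V y))\<^sup>2 = mass U y"
    by (rule mass_balance[OF cp bal y(1)])
  ultimately show False
    using I(3)[OF y(1)] y(2) by (auto simp: mass_def)
qed

text \<open>The conserved quantity \<open>q X\<close> is zero, and \<open>|X| \<le> q\<close> forces \<open>X = 0\<close> even at points
  where \<open>q\<close> might vanish.\<close>

lemma overlap_imaginary:
  assumes cp: "classical_profile I U V" and bal: "cmod (U 0) = cmod (V 0)"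
    and X0: "Re (overlap U V 0) = 0" and y: "y \<in> I"
  shows "Re (overlap U V y) = 0"
proof -
  note I = classical_profile_interval[OF cp]
  have "mass U y * Re (overlap U V y) = mass U 0 * Re (overlap U V 0)"
  proof (rule constant_on_interval[OF I(1,2) y])
    fix t assume t: "t \<in> I"
    show "((\<lambda>y. mass U y * Re (overlap U V y)) has_real_derivative 0) (at t)"
      using DERIV_mult[OF overlap_derivs(3,1)[OF cp bal t]] by (simp add: algebra_simps)
  qed
  then have "cmod (overlap U V y) = 0 \<or> Re (overlap U V y) = 0"
    using X0 overlap_norm[OF cp bal y] by auto
  then show ?thesis by auto
qed

text \<open>Off the line \<open>X = 0\<close> every orbit of the planar system blows up in finite positive time.
  If \<open>Y\<close> is ever positive, \<open>Y' \<ge> Y\<^sup>2\<close> gives blow-up. If \<open>Y \<le> 0\<close> throughout, then \<open>X\<^sup>2\<close> does not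
  decrease, so \<open>Y\<close> grows at least linearly in \<open>\<tau>\<close> and must become positive after all.\<close>

lemma no_extension_if_Re_overlap_nonzero:
  assumes cp: "classical_profile I U V" and bal: "cmod (U 0) = cmod (V 0)"
    and X0: "Re (overlap U V 0) \<noteq> 0"
  shows "\<not> extends_to_plus_one I"
proof
  assume "extends_to_plus_one I"
  then have I: "t \<in> I" if "0 \<le> t" "t < 1" for t
    using that by (auto simp: extends_to_plus_one_def)
  define X Y where "X y = Re (overlap U V y)" and "Y y = Im (overlap U V y)" for y
  define w where "w y = 4 / sqrt (1 - y\<^sup>2) ^ 3" for y :: real
  have dX: "(X has_real_derivative - (w t * X t * Y t)) (at t)"
    and dY: "(Y has_real_derivative w t * (2 * (X t)\<^sup>2 + (Y t)\<^sup>2)) (at t)"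
    and dc: "(clock has_real_derivative w t) (at t)"
    and w: "w t > 0" if "0 \<le> t" "t < 1" for t
    using overlap_derivs(1,2)[OF cp bal I[OF that]] clock_deriv[of t] one_minus_square_pos[of t] that
    by (simp_all add: X_def[abs_def] Y_def[abs_def] w_def)
  have reach: "\<exists>y. s < y \<and> y < 1 \<and> clock y = T" if "0 \<le> s" "s < 1" "clock s < T" for s T
  proof -
    define y where "y = T / sqrt (16 + T\<^sup>2)"
    have y: "clock y = T" "-1 < y" "y < 1"
      using clock_eq[of T] by (auto simp: y_def)
    then have "s < y"
      using clock_strict_mono[of y s] that by (cases y s rule: linorder_cases) auto
    then show ?thesis using y by blast
  qed
  show False
  proof (cases "\<exists>s. 0 \<le> s \<and> s < 1 \<and> Y s > 0")
    case True
    then obtain s where s: "0 \<le> s" "s < 1" "Y s > 0" by blast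
    obtain y where y: "s < y" "y < 1" "clock y = clock s + (1 / Y s + 1)"
      using reach[OF s(1,2), of "clock s + (1 / Y s + 1)"] s(3) by (auto simp: add_pos_pos)
    have pos: "Y t > 0" if "s \<le> t" "t \<le> y" for t
    proof -
      have "Y s \<le> Y t"
      proof (rule DERIV_nonneg_imp_nondecreasing[OF that(1)])
        fix x assume "s \<le> x" "x \<le> t"
        then have x: "0 \<le> x" "x < 1" using s y that by auto
        show "\<exists>d. (Y has_real_derivative d) (at x) \<and> 0 \<le> d"
          using dY[OF x] w[OF x] by (intro exI conjI) auto
      qed
      then show ?thesis using s by simp
    qed
    (* The time at y was chosen so that the Riccati comparison gives 1 / Y y <= -1. *)
    have "- (1 / Y s) - clock s \<le> - (1 / Y y) - clock y"
    proof (rule DERIV_nonneg_imp_nondecreasing[OF less_imp_le[OF y(1)]])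
      fix t assume t: "s \<le> t" "t \<le> y"
      have t': "0 \<le> t" "t < 1" using t s y by auto
      have "((\<lambda>t. - (1 / Y t) - clock t) has_real_derivative
          w t * (2 * (X t)\<^sup>2 + (Y t)\<^sup>2) / (Y t)\<^sup>2 - w t) (at t)"
        using pos[OF t] by (auto intro!: derivative_eq_intros dY[OF t'] dc[OF t'] simp: power2_eq_square)
      also have "w t * (2 * (X t)\<^sup>2 + (Y t)\<^sup>2) / (Y t)\<^sup>2 - w t = 2 * w t * (X t)\<^sup>2 / (Y t)\<^sup>2"
        using pos[OF t] by (simp add: field_simps)
      finally show "\<exists>d. ((\<lambda>t. - (1 / Y t) - clock t) has_real_derivative d) (at t) \<and> 0 \<le> d"
        using w[OF t'] by (intro exI conjI) auto
    qed
    moreover have "1 / Y y > 0"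
      using pos[of y] y by simp
    ultimately show False
      using y(3) by simp
  next
    case False
    then have neg: "Y t \<le> 0" if "0 \<le> t" "t < 1" for t
      using that by force
    have X2: "(X 0)\<^sup>2 \<le> (X t)\<^sup>2" if t: "0 \<le> t" "t < 1" for t
    proof (rule DERIV_nonneg_imp_nondecreasing[OF t(1)])
      fix x assume x: "0 \<le> x" "x \<le> t"
      then have x': "0 \<le> x" "x < 1" using t by auto
      have "((\<lambda>t. (X t)\<^sup>2) has_real_derivative 2 * w x * (X x)\<^sup>2 * - Y x) (at x)"
        by (auto intro!: derivative_eq_intros dX[OF x'] simp: power2_eq_square)
      moreover have "0 \<le> 2 * w x * (X x)\<^sup>2 * - Y x"
        using w[OF x'] neg[OF x'] by (intro mult_nonneg_nonneg) auto
      ultimately show "\<exists>d. ((\<lambda>t. (X t)\<^sup>2) has_real_derivative d) (at x) \<and> 0 \<le> d"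
        by blast
    qed
    have X0: "(X 0)\<^sup>2 > 0" using X0 by (simp add: X_def)
    define T where "T = (1 - Y 0) / (2 * (X 0)\<^sup>2)"
    have "T > 0" using neg[of 0] X0 by (simp add: T_def)
    then obtain y where y: "0 < y" "y < 1" "clock y = T"
      using reach[of 0 T] by (auto simp: clock_def)
    have "Y 0 - 2 * (X 0)\<^sup>2 * clock 0 \<le> Y y - 2 * (X 0)\<^sup>2 * clock y"
    proof (rule DERIV_nonneg_imp_nondecreasing[OF less_imp_le[OF y(1)]])
      fix t assume t: "0 \<le> t" "t \<le> y"
      then have t': "0 \<le> t" "t < 1" using y by auto
      have "((\<lambda>t. Y t - 2 * (X 0)\<^sup>2 * clock t) has_real_derivative
          w t * (2 * ((X t)\<^sup>2 - (X 0)\<^sup>2) + (Y t)\<^sup>2)) (at t)"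
        by (auto intro!: derivative_eq_intros dY[OF t'] dc[OF t'] simp: algebra_simps)
      moreover have "0 \<le> w t * (2 * ((X t)\<^sup>2 - (X 0)\<^sup>2) + (Y t)\<^sup>2)"
        using w[OF t'] X2[OF t'] by (intro mult_nonneg_nonneg add_nonneg_nonneg) auto
      ultimately show "\<exists>d. ((\<lambda>t. Y t - 2 * (X 0)\<^sup>2 * clock t) has_real_derivative d) (at t) \<and> 0 \<le> d"
        by blast
    qed
    moreover have "2 * (X 0)\<^sup>2 * clock y = 1 - Y 0"
      using X0 by (simp add: y(3) T_def)
    ultimately show False
      using neg[of y] y by (simp add: clock_def)
  qed
qed

text \<open>The solution of \<open>Y' = Y\<^sup>2\<close> in a form free of division: the defect
  \<open>Y (1 / Y(0) - \<tau>) - 1\<close> satisfies a linear homogeneous equation with zero initial value. As a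
  consequence \<open>\<tau>\<close> never takes the value \<open>1 / Y(0)\<close> on the interval of existence.\<close>

lemma Im_overlap_riccati:
  assumes cp: "classical_profile I U V" and bal: "cmod (U 0) = cmod (V 0)"
    and X0: "Re (overlap U V 0) = 0" and Y0: "Im (overlap U V 0) \<noteq> 0" and y: "y \<in> I"
  shows "Im (overlap U V y) * (1 / Im (overlap U V 0) - clock y) = 1"
proof -
  note I = classical_profile_interval[OF cp]
  define Y k where "Y y = Im (overlap U V y)" and "k = 1 / Im (overlap U V 0)" for y
  have "Y y * (k - clock y) - 1 = 0"
  proof (rule linear_ode_zero[OF I(1,2) y coeff_continuous[OF cp bal]])
    fix t assume t: "t \<in> I"
    define w where "w = 4 / sqrt (1 - t\<^sup>2) ^ 3"
    have dY: "(Y has_real_derivative w * (Y t)\<^sup>2) (at t)"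
      using overlap_derivs(2)[OF cp bal t] overlap_imaginary[OF cp bal X0 t]
      by (simp add: Y_def[abs_def] w_def)
    have dc: "(clock has_real_derivative w) (at t)"
      using clock_deriv[OF I(3)[OF t]] by (simp add: w_def)
    have "((\<lambda>t. Y t * (k - clock t) - 1) has_real_derivative w * Y t * (Y t * (k - clock t) - 1)) (at t)"
      by (auto intro!: derivative_eq_intros dY dc simp: algebra_simps power2_eq_square)
    then show "((\<lambda>t. Y t * (k - clock t) - 1) has_real_derivative
        4 / sqrt (1 - t\<^sup>2) ^ 3 * Im (overlap U V t) * (Y t * (k - clock t) - 1)) (at t)"
      by (simp add: w_def Y_def)
  qed (use Y0 in \<open>simp add: Y_def k_def clock_def\<close>)
  then show ?thesis by (simp add: Y_def k_def)
qed

section \<open>Symmetries\<close>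

lemma classical_profile_reflect:
  assumes cp: "classical_profile I U V"
  shows "classical_profile (uminus ` I) (\<lambda>y. V (- y)) (\<lambda>y. U (- y))"
  unfolding classical_profile_def
proof (intro conjI ballI)
  have I: "open I" "is_interval I" "0 \<in> I" "I \<subseteq> {-1<..<1}" "U C1_differentiable_on I" "V C1_differentiable_on I"
    and ode: "\<And>y. y \<in> I \<Longrightarrow> profile_ode_at U V y"
    using cp by (auto simp: classical_profile_def)
  have refl: "(\<lambda>y. F (- y)) C1_differentiable_on (uminus ` I)" if F: "F C1_differentiable_on I" for F :: "real \<Rightarrow> complex"
  proof -
    obtain D where D: "\<And>x. x \<in> I \<Longrightarrow> (F has_vector_derivative D x) (at x)" "continuous_on I D"
      using F unfolding C1_differentiable_on_def by blast
    have "((\<lambda>y. F (- y)) has_vector_derivative - D (- x)) (at x)" if "x \<in> uminus ` I" for x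
    proof -
      have "((F \<circ> uminus) has_vector_derivative (-1) *\<^sub>R D (- x)) (at x)"
        using that by (intro vector_diff_chain_at D) (auto intro!: derivative_eq_intros)
      then show ?thesis by (simp add: o_def)
    qed
    moreover have "continuous_on (uminus ` I) (\<lambda>x. - D (- x))"
    proof (rule continuous_on_minus)
      have "continuous_on (uminus ` I) (uminus :: real \<Rightarrow> real)"
        by (rule continuous_on_minus[OF continuous_on_id])
      then show "continuous_on (uminus ` I) (\<lambda>x. D (- x))"
        by (rule continuous_on_compose2[OF D(2)]) (simp add: image_image)
    qed
    ultimately show ?thesis
      unfolding C1_differentiable_on_def by (intro exI[of _ "\<lambda>x. - D (- x)"]) simp
  qed
  show "(\<lambda>y. V (- y)) C1_differentiable_on uminus ` I" "(\<lambda>y. U (- y)) C1_differentiable_on uminus ` I"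
    using I by (auto intro: refl)
  show "open (uminus ` I)" "0 \<in> uminus ` I" "uminus ` I \<subseteq> {- 1<..<1}"
    using I by (auto intro: open_negations)
  show "is_interval (uminus ` I)" using I(2) by simp
  fix y assume "y \<in> uminus ` I"
  then have "- y \<in> I" by auto
  then show "profile_ode_at (\<lambda>y. V (- y)) (\<lambda>y. U (- y)) y"
    using I(5,6) ode by (intro profile_ode_at_reflect) (auto simp: C1_differentiable_on_eq)
qed

lemma balanced_profile_reflect:
  assumes "balanced_profile I U V"
  shows "balanced_profile (uminus ` I) (\<lambda>y. V (- y)) (\<lambda>y. U (- y))"
proof -
  have cp: "classical_profile I U V"
    and max: "\<And>J P Q. classical_profile J P Q \<Longrightarrow> I \<subseteq> J \<Longrightarrow> \<forall>y\<in>I. P y = U y \<and> Q y = V y \<Longrightarrow> J = I"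
    using assms unfolding balanced_profile_def maximal_profile_def by blast+
  have "J = uminus ` I" if J: "classical_profile J P Q" "uminus ` I \<subseteq> J"
    "\<forall>y\<in>uminus ` I. P y = V (- y) \<and> Q y = U (- y)" for J P Q
  proof -
    have "uminus ` J = I"
      using J(2,3) by (intro max[OF classical_profile_reflect[OF J(1)]]) (auto simp: image_iff, force)
    then show ?thesis by (auto simp: image_image)
  qed
  moreover have "\<exists>y\<in>uminus ` I. V (- y) \<noteq> 0 \<or> U (- y) \<noteq> 0" "cmod (V (- 0)) = cmod (U (- 0))"
    using assms by (auto simp: balanced_profile_def)
  ultimately show ?thesis
    using classical_profile_reflect[OF cp]
    unfolding balanced_profile_def maximal_profile_def by blast
qed

lemma classical_profile_phase:
  assumes cp: "classical_profile I U V"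
  shows "classical_profile I (\<lambda>y. cis \<phi> * U y) (\<lambda>y. cis \<phi> * V y)"
proof -
  have C1: "U C1_differentiable_on I" "V C1_differentiable_on I"
    using cp by (auto simp: classical_profile_def)
  have "profile_ode_at (\<lambda>y. cis \<phi> * U y) (\<lambda>y. cis \<phi> * V y) y" if "y \<in> I" for y
    using cp that C1 by (intro profile_ode_at_phase) (auto simp: classical_profile_def C1_differentiable_on_eq)
  then show ?thesis
    using cp by (auto simp: classical_profile_def intro!: C1_differentiable_on_mult C1_differentiable_on_const)
qed

section \<open>The explicit profile\<close>

text \<open>The mass of the profile with \<open>X = 0\<close> and \<open>Y(0) = - r\<^sup>2\<close>, that is, \<open>- Y\<close> from the Riccati
  equation.\<close>

definition decay :: "real \<Rightarrow> real \<Rightarrow> real" where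
  "decay r y = 1 / (1 / r\<^sup>2 + clock y)"

text \<open>The point where \<open>\<tau> = - 1 / r\<^sup>2\<close>, at which the denominator of \<open>decay r\<close> vanishes.\<close>

definition blowup_point :: "real \<Rightarrow> real" where
  "blowup_point r = - 1 / sqrt (16 * r ^ 4 + 1)"

definition u_mod :: "real \<Rightarrow> real \<Rightarrow> real" where
  "u_mod r y = sqrt (decay r y / (1 + y))"

definition v_mod :: "real \<Rightarrow> real \<Rightarrow> real" where
  "v_mod r y = sqrt (decay r y / (1 - y))"

lemma blowup_point:
  assumes "r > 0"
  shows "clock (blowup_point r) = - (1 / r\<^sup>2)" "blowup_point r \<in> {-1<..<0}"
proof -
  have "sqrt (16 + (1 / r\<^sup>2)\<^sup>2) = sqrt (16 * r ^ 4 + 1) / r\<^sup>2"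
  proof -
    have "16 + (1 / r\<^sup>2)\<^sup>2 = (16 * r ^ 4 + 1) / (r\<^sup>2)\<^sup>2"
      using assms by (simp add: field_simps)
    then show ?thesis by (simp only: real_sqrt_divide real_sqrt_abs abs_power2)
  qed
  then have *: "blowup_point r = - (1 / r\<^sup>2) / sqrt (16 + (- (1 / r\<^sup>2))\<^sup>2)"
    using assms by (simp add: blowup_point_def)
  show "clock (blowup_point r) = - (1 / r\<^sup>2)"
    unfolding * by (rule clock_eq)
  have "blowup_point r \<in> {-1<..<1}"
    unfolding * by (rule clock_eq)
  moreover have "blowup_point r < 0"
    using assms by (simp add: blowup_point_def add_pos_pos)
  ultimately show "blowup_point r \<in> {-1<..<0}" by simp
qed

lemma decay_pos:
  assumes "r > 0" "y \<in> {blowup_point r<..<1}"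
  shows "1 / r\<^sup>2 + clock y > 0" "decay r y > 0"
  using clock_strict_mono[of "blowup_point r" y] blowup_point[OF assms(1)] assms(2) by (auto simp: decay_def)

lemma explicit_identities:
  assumes "r > 0" "y \<in> {blowup_point r<..<1}"
  shows "u_mod r y > 0" "v_mod r y > 0"
    and "(1 + y) * (u_mod r y)\<^sup>2 = decay r y" "(1 - y) * (v_mod r y)\<^sup>2 = decay r y"
    and "decay r y = sqrt (1 - y\<^sup>2) * (u_mod r y * v_mod r y)"
proof -
  have y: "1 + y > 0" "1 - y > 0" and q: "decay r y > 0"
    using assms blowup_point[OF assms(1)] decay_pos[OF assms] by auto
  show "u_mod r y > 0" "v_mod r y > 0"
    "(1 + y) * (u_mod r y)\<^sup>2 = decay r y" "(1 - y) * (v_mod r y)\<^sup>2 = decay r y"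
    using y q by (simp_all add: u_mod_def v_mod_def)
  have "1 - y\<^sup>2 = (1 + y) * (1 - y)"
    by (simp add: power2_eq_square algebra_simps)
  then show "decay r y = sqrt (1 - y\<^sup>2) * (u_mod r y * v_mod r y)"
    using y q by (simp add: u_mod_def v_mod_def real_sqrt_mult real_sqrt_divide)
qed

lemma decay_deriv:
  assumes "r > 0" "y \<in> {blowup_point r<..<1}"
  shows "(decay r has_real_derivative - (decay r y)\<^sup>2 * (4 / sqrt (1 - y\<^sup>2) ^ 3)) (at y)"
proof -
  have y: "y \<in> {-1<..<1}" using assms blowup_point[OF assms(1)] by auto
  have p: "1 / r\<^sup>2 + clock y \<noteq> 0" using decay_pos[OF assms] by simp
  define w where "w = 4 / sqrt (1 - y\<^sup>2) ^ 3"
  have "((\<lambda>y. 1 / r\<^sup>2 + clock y) has_real_derivative w) (at y)"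
    unfolding w_def by (rule derivative_eq_intros refl clock_deriv[OF y])+ simp
  from DERIV_inverse_fun[OF this p]
  show ?thesis
    using p unfolding w_def[symmetric]
    by (simp add: decay_def[abs_def] inverse_eq_divide power_divide power2_eq_square)
qed

text \<open>For \<open>U = u\<close> and \<open>V = - i v\<close> with \<open>u\<close> and \<open>v\<close> real the term \<open>U cnj V + cnj U V\<close> vanishes and
  the profile equations become this real system.\<close>

lemma explicit_derivs:
  assumes "r > 0" "y \<in> {blowup_point r<..<1}"
  defines "n \<equiv> (u_mod r y)\<^sup>2 + (v_mod r y)\<^sup>2"
  shows "(u_mod r has_real_derivative (- (u_mod r y) / 2 - n * v_mod r y) / (1 + y)) (at y)"
    and "(v_mod r has_real_derivative (v_mod r y / 2 - n * u_mod r y) / (1 - y)) (at y)"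
proof -
  define u v q S where "u = u_mod r y" and "v = v_mod r y" and "q = decay r y" and "S = sqrt (1 - y\<^sup>2)"
  have y: "1 + y > 0" "1 - y > 0" "y \<in> {-1<..<1}"
    using assms blowup_point[OF assms(1)] by auto
  have uv: "u > 0" "v > 0" "(1 + y) * u\<^sup>2 = q" "(1 - y) * v\<^sup>2 = q" "q = S * (u * v)"
    using explicit_identities[OF assms(1,2)] by (simp_all add: u_def v_def q_def S_def)
  have S: "S > 0" "S\<^sup>2 = (1 + y) * (1 - y)"
    using one_minus_square_pos[OF y(3)] by (simp_all add: S_def power2_eq_square algebra_simps)
  have n: "n * S\<^sup>2 = 2 * q"
  proof -
    have "n * S\<^sup>2 = (1 - y) * ((1 + y) * u\<^sup>2) + (1 + y) * ((1 - y) * v\<^sup>2)"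
      by (simp add: n_def u_def v_def S(2) algebra_simps)
    also have "\<dots> = (1 - y) * q + (1 + y) * q"
      by (simp only: uv(3,4))
    finally show ?thesis by (simp add: algebra_simps)
  qed
  have dq: "q\<^sup>2 * (4 / S ^ 3) = 2 * n * u * v"
  proof -
    have "q\<^sup>2 * (4 / S ^ 3) * S\<^sup>2 = 2 * (2 * q) * (u * v)"
      using S(1) by (simp add: uv(5) power2_eq_square power3_eq_cube)
    also have "\<dots> = 2 * n * u * v * S\<^sup>2"
      unfolding n[symmetric] by (simp add: algebra_simps)
    finally show ?thesis
      by (subst (asm) mult_right_cancel) (use S(1) in auto)
  qed
  have cancel: "inverse x / 2 * (2 * x * c * k / (c * c)) = k / c" if "x > 0" "c > 0" for x c k :: real
    using that by (simp add: field_simps)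
  note d = decay_deriv[OF assms(1,2), folded q_def S_def]
  have d': "(decay r has_real_derivative - (2 * n * u * v)) (at y)"
    using d dq by simp
  have pos: "0 < decay r y / (1 + y)" "0 < decay r y / (1 - y)"
    using decay_pos[OF assms(1,2)] y by auto
  have "((\<lambda>y. decay r y / (1 + y)) has_real_derivative
      (- (2 * n * u * v) * (1 + y) - q * 1) / ((1 + y) * (1 + y))) (at y)"
    unfolding q_def by (rule DERIV_divide[OF d']) (use y in \<open>auto intro!: derivative_eq_intros\<close>)
  from DERIV_chain2[OF DERIV_real_sqrt[OF pos(1)] this]
  have "(u_mod r has_real_derivative
      inverse u / 2 * ((- (2 * n * u * v) * (1 + y) - (1 + y) * u\<^sup>2) / ((1 + y) * (1 + y)))) (at y)"
    unfolding u_mod_def[symmetric] u_def[symmetric] uv(3) by simp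
  moreover have "inverse u / 2 * ((- (2 * n * u * v) * (1 + y) - (1 + y) * u\<^sup>2) / ((1 + y) * (1 + y)))
      = (- u / 2 - n * v) / (1 + y)"
  proof -
    have "- (2 * n * u * v) * (1 + y) - (1 + y) * u\<^sup>2 = (2 * u * (1 + y)) * (- u / 2 - n * v)"
      by (simp add: algebra_simps power2_eq_square)
    then show ?thesis
      by (simp only:) (rule cancel[OF uv(1) y(1)])
  qed
  ultimately show "(u_mod r has_real_derivative (- (u_mod r y) / 2 - n * v_mod r y) / (1 + y)) (at y)"
    by (simp add: u_def v_def)
  have "((\<lambda>y. decay r y / (1 - y)) has_real_derivative
      (- (2 * n * u * v) * (1 - y) - q * (- 1)) / ((1 - y) * (1 - y))) (at y)"
    unfolding q_def by (rule DERIV_divide[OF d']) (use y in \<open>auto intro!: derivative_eq_intros\<close>)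
  from DERIV_chain2[OF DERIV_real_sqrt[OF pos(2)] this]
  have "(v_mod r has_real_derivative
      inverse v / 2 * ((- (2 * n * u * v) * (1 - y) - (1 - y) * v\<^sup>2 * (- 1)) / ((1 - y) * (1 - y)))) (at y)"
    unfolding v_mod_def[symmetric] v_def[symmetric] uv(4) by simp
  moreover have "inverse v / 2 * ((- (2 * n * u * v) * (1 - y) - (1 - y) * v\<^sup>2 * (- 1)) / ((1 - y) * (1 - y)))
      = (v / 2 - n * u) / (1 - y)"
  proof -
    have "- (2 * n * u * v) * (1 - y) - (1 - y) * v\<^sup>2 * (- 1) = (2 * v * (1 - y)) * (v / 2 - n * u)"
      by (simp add: algebra_simps power2_eq_square)
    then show ?thesis
      by (simp only:) (rule cancel[OF uv(2) y(2)])
  qed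
  ultimately show "(v_mod r has_real_derivative (v_mod r y / 2 - n * u_mod r y) / (1 - y)) (at y)"
    by (simp add: u_def v_def)
qed

definition U_sol :: "real \<Rightarrow> real \<Rightarrow> complex" where
  "U_sol r y = of_real (u_mod r y)"

definition V_sol :: "real \<Rightarrow> real \<Rightarrow> complex" where
  "V_sol r y = - \<i> * of_real (v_mod r y)"

lemma explicit_classical:
  assumes r: "r > 0"
  shows "classical_profile {blowup_point r<..<1} (U_sol r) (V_sol r)"
proof -
  let ?I = "{blowup_point r<..<1}"
  define n where "n y = (u_mod r y)\<^sup>2 + (v_mod r y)\<^sup>2" for y
  define u' v' where "u' y = (- (u_mod r y) / 2 - n y * v_mod r y) / (1 + y)"
    and "v' y = (v_mod r y / 2 - n y * u_mod r y) / (1 - y)" for y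
  have du: "(u_mod r has_real_derivative u' y) (at y)"
    and dv: "(v_mod r has_real_derivative v' y) (at y)" if "y \<in> ?I" for y
    using explicit_derivs[OF r that] by (simp_all add: u'_def v'_def n_def)
  have dU: "(U_sol r has_vector_derivative of_real (u' y)) (at y)"
    and dV: "(V_sol r has_vector_derivative - \<i> * of_real (v' y)) (at y)" if y: "y \<in> ?I" for y
    unfolding U_sol_def[abs_def] V_sol_def[abs_def]
    by (intro has_vector_derivative_mult_right has_vector_derivative_of_real du[OF y] dv[OF y])+
  have y1: "1 + y > 0" "1 - y > 0" if "y \<in> ?I" for y
    using that blowup_point[OF r] by auto
  have cont: "continuous_on ?I (u_mod r)" "continuous_on ?I (v_mod r)"
    using du dv DERIV_isCont by (blast intro: continuous_at_imp_continuous_on)+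
  have "continuous_on ?I u'" "continuous_on ?I v'"
    unfolding u'_def v'_def n_def
    by (intro continuous_intros cont; use y1 in force)+
  then have C1: "U_sol r C1_differentiable_on ?I" "V_sol r C1_differentiable_on ?I"
    unfolding C1_differentiable_on_def
    by (intro exI[of _ "\<lambda>y. of_real (u' y)"] exI[of _ "\<lambda>y. - \<i> * of_real (v' y)"];
        use dU dV in \<open>auto intro!: continuous_intros\<close>)+
  have "profile_ode_at (U_sol r) (V_sol r) y" if y: "y \<in> ?I" for y
  proof -
    have p: "U_sol r y * cnj (V_sol r y) + cnj (U_sol r y) * V_sol r y = 0"
      by (simp add: U_sol_def V_sol_def)
    have n: "(cmod (U_sol r y))\<^sup>2 + (cmod (V_sol r y))\<^sup>2 = n y"
      by (simp add: U_sol_def V_sol_def n_def norm_mult)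
    have e: "(y + 1) * u' y + u_mod r y / 2 = - (n y * v_mod r y)"
      "(y - 1) * v' y + v_mod r y / 2 = n y * u_mod r y"
    proof -
      have "(y + 1) * u' y = - (u_mod r y) / 2 - n y * v_mod r y"
        using y1[OF y] by (simp add: u'_def add.commute)
      then show "(y + 1) * u' y + u_mod r y / 2 = - (n y * v_mod r y)" by simp
      have "(1 - y) * v' y = v_mod r y / 2 - n y * u_mod r y"
        using y1[OF y] by (simp add: v'_def)
      then show "(y - 1) * v' y + v_mod r y / 2 = n y * u_mod r y" by (simp add: algebra_simps)
    qed
    have "\<i> * (of_real (y + 1) * of_real (u' y) + 1 / 2 * U_sol r y)
        = \<i> * of_real ((y + 1) * u' y + u_mod r y / 2)"
      by (simp add: U_sol_def)
    also have "\<dots> = of_real (n y) * V_sol r y"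
      unfolding e by (simp add: V_sol_def)
    finally have 1: "\<i> * (of_real (y + 1) * of_real (u' y) + 1 / 2 * U_sol r y)
        = of_real (n y) * V_sol r y" .
    have "\<i> * (of_real (y - 1) * (- \<i> * of_real (v' y)) + 1 / 2 * V_sol r y)
        = of_real ((y - 1) * v' y + v_mod r y / 2)"
      by (simp add: V_sol_def algebra_simps)
    also have "\<dots> = of_real (n y) * U_sol r y"
      unfolding e by (simp add: U_sol_def)
    finally show ?thesis
      unfolding profile_ode_at_def p n vector_derivative_at[OF dU[OF y]] vector_derivative_at[OF dV[OF y]]
      using 1 by simp
  qed
  then show ?thesis
    using C1 blowup_point[OF r] by (auto simp: classical_profile_def is_interval_oo)
qed

lemma explicit_at_zero:
  assumes "r > 0"
  shows "U_sol r 0 = of_real r" "V_sol r 0 = - \<i> * of_real r"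
  using assms by (simp_all add: U_sol_def V_sol_def u_mod_def v_mod_def decay_def clock_def)

lemma cmod_explicit:
  assumes "r > 0" "y \<in> {blowup_point r<..<1}"
  shows "cmod (U_sol r y) = u_mod r y" "cmod (V_sol r y) = v_mod r y"
  using explicit_identities(1,2)[OF assms] by (simp_all add: U_sol_def V_sol_def norm_mult)

text \<open>The mass tends to infinity while the weights \<open>1 + y\<close> and \<open>1 - y\<close> stay between positive
  bounds, since the blow-up point is interior to \<open>(-1, 1)\<close>.\<close>

lemma explicit_blowup:
  assumes r: "r > 0"
  shows "filterlim (U_sol r) at_infinity (at_right (blowup_point r))"
    and "filterlim (V_sol r) at_infinity (at_right (blowup_point r))"
proof -
  let ?F = "at_right (blowup_point r)"
  have s: "blowup_point r \<in> {-1<..<1}" using blowup_point[OF r] by auto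
  have "((\<lambda>y. 1 / r\<^sup>2 + clock y) \<longlongrightarrow> 1 / r\<^sup>2 + clock (blowup_point r)) ?F"
    by (intro tendsto_intros tendsto_within_subset[OF DERIV_isCont[OF clock_deriv[OF s], unfolded isCont_def]]) simp
  then have lim: "((\<lambda>y. 1 / r\<^sup>2 + clock y) \<longlongrightarrow> 0) ?F"
    by (simp add: blowup_point[OF r])
  have ev: "\<forall>\<^sub>F y in ?F. y \<in> {blowup_point r<..<1}"
    using s by (intro eventually_at_right_real) auto
  then have "\<forall>\<^sub>F y in ?F. 0 < 1 / r\<^sup>2 + clock y"
    by eventually_elim (rule decay_pos[OF r])
  then have q: "filterlim (decay r) at_top ?F"
    using filterlim_inverse_at_top[OF lim] by (simp add: decay_def[abs_def] inverse_eq_divide)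
  have "filterlim (\<lambda>y. inverse (1 + y) * decay r y) at_top ?F"
    using s by (intro filterlim_tendsto_pos_mult_at_top[OF _ _ q, of _ "inverse (1 + blowup_point r)"])
      (auto intro!: tendsto_eq_intros)
  then have "filterlim (u_mod r) at_top ?F"
    unfolding u_mod_def[abs_def]
    by (intro filterlim_compose[OF sqrt_at_top]) (simp add: field_simps)
  then show "filterlim (U_sol r) at_infinity ?F"
    unfolding U_sol_def[abs_def]
    by (intro filterlim_norm_at_top_imp_at_infinity) (erule filterlim_at_top_mono, simp add: always_eventually abs_ge_self)
  have "filterlim (\<lambda>y. inverse (1 - y) * decay r y) at_top ?F"
    using s by (intro filterlim_tendsto_pos_mult_at_top[OF _ _ q, of _ "inverse (1 - blowup_point r)"])
      (auto intro!: tendsto_eq_intros)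
  then have "filterlim (v_mod r) at_top ?F"
    unfolding v_mod_def[abs_def]
    by (intro filterlim_compose[OF sqrt_at_top]) (simp add: field_simps)
  then show "filterlim (V_sol r) at_infinity ?F"
    unfolding V_sol_def[abs_def]
    by (intro filterlim_norm_at_top_imp_at_infinity)
      (erule filterlim_at_top_mono, simp add: norm_mult always_eventually abs_ge_self)
qed

text \<open>A larger interval of existence would contain the blow-up point, and a continuous
  continuation has a finite limit there.\<close>

lemma explicit_maximal:
  assumes r: "r > 0"
    and J: "classical_profile J P Q" "{blowup_point r<..<1} \<subseteq> J"
      "\<And>y. y \<in> {blowup_point r<..<1} \<Longrightarrow> P y = U_sol r y"
  shows "J = {blowup_point r<..<1}"
proof (rule ccontr)
  assume "J \<noteq> {blowup_point r<..<1}"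
  then obtain x where x: "x \<in> J" "x \<notin> {blowup_point r<..<1}"
    using J(2) by blast
  note I = classical_profile_interval[OF J(1)]
  have "x \<le> blowup_point r" using x I(3)[OF x(1)] by auto
  then have "blowup_point r \<in> J"
    using mem_is_interval_1_I[OF I(1) x(1) I(2)] blowup_point[OF r] by auto
  then have "isCont P (blowup_point r)"
    using profile_odeD(1)[OF J(1)] has_vector_derivative_continuous by blast
  then have "((\<lambda>y. P y) \<longlongrightarrow> P (blowup_point r)) (at_right (blowup_point r))"
    by (auto simp: isCont_def intro: tendsto_within_subset)
  moreover have "\<forall>\<^sub>F y in at_right (blowup_point r). P y = U_sol r y"
  proof -
    have "\<forall>\<^sub>F y in at_right (blowup_point r). y \<in> {blowup_point r<..<1}"
      using blowup_point[OF r] by (intro eventually_at_right_real) auto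
    then show ?thesis
      by eventually_elim (simp add: J(3))
  qed
  ultimately have "(U_sol r \<longlongrightarrow> P (blowup_point r)) (at_right (blowup_point r))"
    by (rule Lim_transform_eventually)
  then show False
    using explicit_blowup(1)[OF r] not_tendsto_and_filterlim_at_infinity[of "at_right (blowup_point r)"]
    by (auto simp: trivial_limit_at_right_real)
qed

text \<open>Since \<open>\<tau>\<close> is of the order \<open>(1 - y) powr (- 1 / 2)\<close> near \<open>y = 1\<close>, the mass decays like
  \<open>sqrt (1 - y)\<close>. Dividing by \<open>1 + y\<close> or \<open>1 - y\<close> and taking square roots gives the two exponents.\<close>

lemma explicit_asymptotics:
  assumes r: "r > 0"
  shows "\<exists>c>0. (\<lambda>y. cmod (U_sol r y)) \<sim>[at_left 1] (\<lambda>y. c * (1 - y) powr (1 / 4))"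
    and "\<exists>c>0. (\<lambda>y. cmod (V_sol r y)) \<sim>[at_left 1] (\<lambda>y. c * (1 - y) powr (- 1 / 4))"
proof -
  let ?F = "at_left (1 :: real)"
  (* G is decay r y / sqrt (1 - y), written so that it is visibly continuous at 1. *)
  define G where "G y = 1 / (sqrt (1 - y) / r\<^sup>2 + 4 * y / sqrt (1 + y))" for y
  have G: "(G \<longlongrightarrow> sqrt 2 / 4) ?F"
    using r unfolding G_def by (auto intro!: tendsto_eq_intros)
  have ev: "\<forall>\<^sub>F y in ?F. y \<in> {0<..<1}"
    by (rule eventually_at_left_real) simp
  have dec: "decay r y = sqrt (1 - y) * G y" if "y \<in> {0<..<1}" for y
  proof -
    have "1 - y\<^sup>2 = (1 + y) * (1 - y)" by (simp add: power2_eq_square algebra_simps)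
    then have "clock y * sqrt (1 - y) = 4 * y / sqrt (1 + y)"
      using that by (simp add: clock_def real_sqrt_mult)
    then have "sqrt (1 - y) / r\<^sup>2 + 4 * y / sqrt (1 + y) = sqrt (1 - y) * (1 / r\<^sup>2 + clock y)"
      by (simp add: algebra_simps)
    then show ?thesis
      using that by (simp add: G_def decay_def)
  qed
  have pw: "(1 - y) powr (1 / 4) = sqrt (sqrt (1 - y))" if "y < 1" for y :: real
    using that by (simp add: powr_half_sqrt[symmetric] powr_powr)
  have "((\<lambda>y. sqrt (G y / (1 + y))) \<longlongrightarrow> sqrt (sqrt 2 / 4 / 2)) ?F"
    by (intro tendsto_intros tendsto_real_sqrt tendsto_divide G) (auto intro!: tendsto_eq_intros)
  moreover have "\<forall>\<^sub>F y in ?F. sqrt (G y / (1 + y)) = cmod (U_sol r y) / (1 - y) powr (1 / 4)"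
    using ev
  proof eventually_elim
    case (elim y)
    then have "cmod (U_sol r y) = sqrt (sqrt (1 - y)) * sqrt (G y / (1 + y))"
      using cmod_explicit(1)[OF r, of y] blowup_point[OF r]
      by (simp add: u_mod_def dec real_sqrt_mult real_sqrt_divide)
    then show ?case using elim by (simp add: pw)
  qed
  ultimately have "((\<lambda>y. cmod (U_sol r y) / (1 - y) powr (1 / 4)) \<longlongrightarrow> sqrt (sqrt 2 / 4 / 2)) ?F"
    by (rule Lim_transform_eventually)
  then show "\<exists>c>0. (\<lambda>y. cmod (U_sol r y)) \<sim>[at_left 1] (\<lambda>y. c * (1 - y) powr (1 / 4))"
    by (intro exI[of _ "sqrt (sqrt 2 / 4 / 2)"] conjI asymp_equivI'_const) auto
  have "((\<lambda>y. sqrt (G y)) \<longlongrightarrow> sqrt (sqrt 2 / 4)) ?F"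
    by (intro tendsto_real_sqrt G)
  moreover have "\<forall>\<^sub>F y in ?F. sqrt (G y) = cmod (V_sol r y) / (1 - y) powr (- 1 / 4)"
    using ev
  proof eventually_elim
    case (elim y)
    have "sqrt (sqrt (1 - y)) * sqrt (sqrt (1 - y)) = sqrt (1 - y)"
      using elim by simp
    then have "sqrt (sqrt (1 - y)) / sqrt (1 - y) = 1 / sqrt (sqrt (1 - y))"
      using elim by (simp add: field_simps)
    moreover have "cmod (V_sol r y) = sqrt (G y) * (sqrt (sqrt (1 - y)) / sqrt (1 - y))"
      using elim cmod_explicit(2)[OF r, of y] blowup_point[OF r]
      by (simp add: v_mod_def dec real_sqrt_mult real_sqrt_divide)
    ultimately show ?case using elim by (simp add: pw powr_minus_divide)
  qed
  ultimately have "((\<lambda>y. cmod (V_sol r y) / (1 - y) powr (- 1 / 4)) \<longlongrightarrow> sqrt (sqrt 2 / 4)) ?F"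
    by (rule Lim_transform_eventually)
  then show "\<exists>c>0. (\<lambda>y. cmod (V_sol r y)) \<sim>[at_left 1] (\<lambda>y. c * (1 - y) powr (- 1 / 4))"
    by (intro exI[of _ "sqrt (sqrt 2 / 4)"] conjI asymp_equivI'_const) auto
qed

section \<open>Classification\<close>

lemma overlap_at_zero:
  assumes "cmod (U 0) = r" "cmod (V 0) = r" "Re (overlap U V 0) = 0"
  shows "Im (overlap U V 0) = r\<^sup>2 \<or> Im (overlap U V 0) = - r\<^sup>2"
proof -
  have "cmod (overlap U V 0) = r\<^sup>2"
    using assms by (simp add: overlap_def norm_mult power2_eq_square)
  then show ?thesis
    using assms(3) by (auto simp: cmod_def abs_if split: if_splits)
qed

text \<open>With \<open>Y(0) = - r\<^sup>2\<close> the Riccati formula excludes \<open>\<tau> = - 1 / r\<^sup>2\<close>, so the interval of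
  existence cannot go beyond the blow-up point, and on it the overlap is known explicitly.\<close>

lemma negative_overlap_profile:
  assumes cp: "classical_profile J P Q" and bal: "cmod (P 0) = cmod (Q 0)" and r: "r > 0"
    and X0: "Re (overlap P Q 0) = 0" and Y0: "Im (overlap P Q 0) = - r\<^sup>2"
    and y: "y \<in> J"
  shows "y \<in> {blowup_point r<..<1}" "mass P y = decay r y" "overlap P Q y = - \<i> * of_real (decay r y)"
proof -
  note I = classical_profile_interval[OF cp]
  have ric: "Im (overlap P Q t) * (1 / r\<^sup>2 + clock t) = - 1" if "t \<in> J" for t
    using Im_overlap_riccati[OF cp bal X0 _ that] Y0 r by (simp add: algebra_simps)
  have "y > blowup_point r"
  proof (rule ccontr)
    assume "\<not> y > blowup_point r"
    then have "blowup_point r \<in> J"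
      using mem_is_interval_1_I[OF I(1) y I(2)] blowup_point[OF r] by auto
    then show False
      using ric[of "blowup_point r"] blowup_point[OF r] by simp
  qed
  then show D: "y \<in> {blowup_point r<..<1}"
    using I(3)[OF y] by simp
  have Y: "Im (overlap P Q y) = - decay r y"
    using ric[OF y] decay_pos[OF r D] by (simp add: decay_def field_simps)
  show ov: "overlap P Q y = - \<i> * of_real (decay r y)"
    using Y overlap_imaginary[OF cp bal X0 y] by (simp add: complex_eq_iff)
  show "mass P y = decay r y"
    using overlap_norm[OF cp bal y] decay_pos[OF r D] by (simp add: ov norm_mult)
qed

text \<open>Knowing the overlap and the moduli determines \<open>V\<close> from \<open>U\<close>. Substituting this into the
  first equation turns it into a linear equation \<open>U' = a U\<close> with a real coefficient \<open>a\<close>, which the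
  explicit modulus solves as well. Hence \<open>U\<close> divided by that modulus is a constant, of absolute
  value one.\<close>

lemma negative_overlap_unique:
  assumes cp: "classical_profile J P Q" and bal: "cmod (P 0) = cmod (Q 0)" and r: "r > 0"
    and X0: "Re (overlap P Q 0) = 0" and Y0: "Im (overlap P Q 0) = - r\<^sup>2"
  shows "\<exists>\<phi>. \<forall>y\<in>J. P y = cis \<phi> * U_sol r y \<and> Q y = cis \<phi> * V_sol r y"
proof -
  note I = classical_profile_interval[OF cp]
  note N = negative_overlap_profile[OF cp bal r X0 Y0]
  have moduli: "cmod (P y) = u_mod r y" "cmod (Q y) = v_mod r y" if y: "y \<in> J" for y
  proof -
    have *: "0 < 1 + y" "0 < 1 - y" using I(3)[OF y] by auto
    have "(1 + y) * (cmod (P y))\<^sup>2 = (1 + y) * (u_mod r y)\<^sup>2"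
      "(1 - y) * (cmod (Q y))\<^sup>2 = (1 - y) * (v_mod r y)\<^sup>2"
      using N(2)[OF y] mass_balance[OF cp bal y] explicit_identities(3,4)[OF r N(1)[OF y]]
      by (simp_all add: mass_def)
    then show "cmod (P y) = u_mod r y" "cmod (Q y) = v_mod r y"
      using * explicit_identities(1,2)[OF r N(1)[OF y]] by (auto simp: power2_eq_iff_nonneg)
  qed
  have QP: "Q y * cnj (P y) = - \<i> * of_real (u_mod r y) * of_real (v_mod r y)" if y: "y \<in> J" for y
  proof -
    define u v S where "u = u_mod r y" and "v = v_mod r y" and "S = sqrt (1 - y\<^sup>2)"
    have uv: "u > 0" "decay r y = S * (u * v)"
      using explicit_identities[OF r N(1)[OF y]] by (simp_all add: u_def v_def S_def)
    have S: "S > 0"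
      using one_minus_square_pos[OF I(3)[OF y]] by (simp add: S_def)
    have "of_real S * (Q y * cnj (P y)) = - \<i> * of_real (S * (u * v))"
      using N(3)[OF y] unfolding overlap_def S_def[symmetric] uv(2) .
    then have "of_real S * (Q y * cnj (P y)) = of_real S * (- \<i> * of_real u * of_real v)"
      by simp
    then show ?thesis
      unfolding u_def[symmetric] v_def[symmetric]
      using S by (subst (asm) mult_left_cancel) auto
  qed
  have Q: "Q y * of_real (u_mod r y) = - \<i> * of_real (v_mod r y) * P y" if y: "y \<in> J" for y
  proof -
    define u v where "u = u_mod r y" and "v = v_mod r y"
    have uv: "u > 0"
      using explicit_identities[OF r N(1)[OF y]] by (simp add: u_def)
    have "Q y * cnj (P y) = - \<i> * of_real u * of_real v"
      using QP[OF y] by (simp add: u_def v_def)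
    then have "Q y * (P y * cnj (P y)) = - \<i> * of_real u * of_real v * P y"
      by (metis mult.assoc mult.commute)
    moreover have "P y * cnj (P y) = of_real u * of_real u"
      unfolding complex_norm_square[symmetric] moduli(1)[OF y] by (simp add: u_def power2_eq_square)
    ultimately have "of_real u * (Q y * of_real u) = of_real u * (- \<i> * of_real v * P y)"
      by (simp add: mult_ac)
    then show ?thesis
      unfolding u_def[symmetric] v_def[symmetric]
      using uv by (subst (asm) mult_left_cancel) auto
  qed
  have R': "((\<lambda>y. inverse (u_mod r y) *\<^sub>R P y) has_vector_derivative 0) (at y)" if y: "y \<in> J" for y
  proof -
    define u v n where "u = u_mod r y" and "v = v_mod r y" and "n = u\<^sup>2 + v\<^sup>2"
    define c where "c = (- u / 2 - n * v) / (1 + y)"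
    have u: "u > 0" and y1: "1 + y \<noteq> 0"
      using explicit_identities(1)[OF r N(1)[OF y]] I(3)[OF y] by (auto simp: u_def)
    have y1': "complex_of_real (1 + y) \<noteq> 0"
      using y1 unfolding of_real_eq_0_iff .
    have du: "(u_mod r has_real_derivative c) (at y)"
      using explicit_derivs(1)[OF r N(1)[OF y]] unfolding c_def n_def u_def v_def .
    have "Re (Q y * cnj (P y)) = 0"
      unfolding QP[OF y] by simp
    moreover have "P y * cnj (Q y) + cnj (P y) * Q y = of_real (2 * Re (Q y * cnj (P y)))"
      by (simp add: complex_eq_iff algebra_simps)
    ultimately have p: "P y * cnj (Q y) + cnj (P y) * Q y = 0"
      by simp
    have rhs: "- (P y / 2) - \<i> * (of_real n * Q y) = of_real (1 + y) * ((c / u) *\<^sub>R P y)"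
    proof -
      have "of_real u * (- (P y / 2) - \<i> * (of_real n * Q y))
          = - of_real u * (P y / 2) - \<i> * of_real n * (Q y * of_real u)"
        by (simp add: algebra_simps)
      also have "\<dots> = of_real (- u / 2 - n * v) * P y"
        unfolding Q[OF y, folded u_def v_def] by (simp add: algebra_simps)
      also have "- u / 2 - n * v = u * ((1 + y) * (c / u))"
        using u y1 by (simp add: c_def)
      also have "of_real (u * ((1 + y) * (c / u))) * P y = of_real u * (of_real (1 + y) * ((c / u) *\<^sub>R P y))"
        unfolding scaleR_conv_of_real of_real_mult by (simp only: mult.assoc)
      finally show ?thesis
        using u by (subst (asm) mult_left_cancel) auto
    qed
    have "(P has_vector_derivative (- (P y / 2) - \<i> * (of_real n * Q y)) / of_real (1 + y)) (at y)"
      using profile_odeD(1)[OF cp y]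
      unfolding p moduli[OF y] u_def[symmetric] v_def[symmetric] n_def[symmetric] by simp
    then have dP: "(P has_vector_derivative (c / u) *\<^sub>R P y) (at y)"
      unfolding rhs nonzero_mult_div_cancel_left[OF y1'] .
    have "((\<lambda>y. inverse (u_mod r y)) has_real_derivative - (inverse u * c * inverse u)) (at y)"
      using DERIV_inverse'[OF du] u by (simp add: u_def)
    from has_vector_derivative_scaleR[OF this dP]
    show ?thesis
      unfolding u_def[symmetric] by (simp add: divide_inverse mult_ac)
  qed
  obtain k where k: "inverse (u_mod r y) *\<^sub>R P y = k" if "y \<in> J" for y
    using has_vector_derivative_zero_constant[of J "\<lambda>y. inverse (u_mod r y) *\<^sub>R P y"]
      is_interval_convex[OF I(1)] R' has_vector_derivative_at_within by blast
  have P: "P y = k * of_real (u_mod r y)" and Qk: "Q y = k * (- \<i> * of_real (v_mod r y))" if y: "y \<in> J" for y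
  proof -
    have u: "u_mod r y > 0" using explicit_identities(1)[OF r N(1)[OF y]] .
    show P: "P y = k * of_real (u_mod r y)"
      unfolding k[OF y, symmetric] using u by (simp add: scaleR_conv_of_real)
    show "Q y = k * (- \<i> * of_real (v_mod r y))"
    proof -
      have "of_real (u_mod r y) * Q y = of_real (u_mod r y) * (k * (- \<i> * of_real (v_mod r y)))"
        using Q[OF y] unfolding P by (simp add: mult_ac)
      then show ?thesis
        by (subst (asm) mult_left_cancel) (use u in auto)
    qed
  qed
  have "cmod k = 1"
    using P[OF I(2)] moduli(1)[OF I(2)] explicit_identities(1)[OF r N(1)[OF I(2)]]
    by (simp add: norm_mult)
  then obtain \<phi> where "k = cis \<phi>"
    by (metis mult_1 of_real_1 rcis_cmod_Arg rcis_def)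
  then show ?thesis
    using P Qk by (intro exI[of _ \<phi>]) (auto simp: U_sol_def V_sol_def)
qed

text \<open>The explicit profile, rotated by the phase found above, continues the given one to all of
  \<open>(blowup_point r, 1)\<close>; maximality leaves no room for a strict continuation.\<close>

lemma negative_overlap_equal_up_to_phase:
  assumes bp: "balanced_profile J P Q" and P0: "cmod (P 0) = r"
    and X0: "Re (overlap P Q 0) = 0" and Y0: "Im (overlap P Q 0) = - r\<^sup>2"
  shows "equal_up_to_phase J P Q {blowup_point r<..<1} (U_sol r) (V_sol r)"
proof -
  have cp: "classical_profile J P Q" and bal: "cmod (P 0) = cmod (Q 0)"
    and max: "\<And>K F G. classical_profile K F G \<Longrightarrow> J \<subseteq> K \<Longrightarrow> \<forall>y\<in>J. F y = P y \<and> G y = Q y \<Longrightarrow> K = J"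
    using bp unfolding balanced_profile_def maximal_profile_def by blast+
  have r: "r > 0"
    using balanced_profile_nonzero[OF bp] P0 by auto
  obtain \<phi> where \<phi>: "\<And>y. y \<in> J \<Longrightarrow> P y = cis \<phi> * U_sol r y \<and> Q y = cis \<phi> * V_sol r y"
    using negative_overlap_unique[OF cp bal r X0 Y0] by blast
  have "{blowup_point r<..<1} = J"
    using negative_overlap_profile(1)[OF cp bal r X0 Y0] \<phi>
    by (intro max[OF classical_profile_phase[OF explicit_classical[OF r], of \<phi>]]) auto
  then show ?thesis
    using \<phi> by (auto simp: equal_up_to_phase_def)
qed

lemma explicit_balanced:
  assumes r: "r > 0"
  shows "balanced_profile {blowup_point r<..<1} (U_sol r) (V_sol r)"
  unfolding balanced_profile_def maximal_profile_def
proof (intro conjI allI impI)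
  show "classical_profile {blowup_point r<..<1} (U_sol r) (V_sol r)"
    by (rule explicit_classical[OF r])
  show "\<exists>y\<in>{blowup_point r<..<1}. U_sol r y \<noteq> 0 \<or> V_sol r y \<noteq> 0"
    using blowup_point[OF r] explicit_at_zero[OF r] r by (intro bexI[of _ 0]) auto
  show "cmod (U_sol r 0) = cmod (V_sol r 0)"
    by (simp add: explicit_at_zero[OF r] norm_mult)
  fix J P Q
  assume "classical_profile J P Q \<and> {blowup_point r<..<1} \<subseteq> J \<and>
    (\<forall>y\<in>{blowup_point r<..<1}. P y = U_sol r y \<and> Q y = V_sol r y)"
  then show "J = {blowup_point r<..<1}"
    by (intro explicit_maximal[OF r, of J P Q]) auto
qed

text \<open>Of the two orbits on the line \<open>X = 0\<close>, the one with \<open>Y(0) = r\<^sup>2\<close> blows up at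
  \<open>\<tau> = 1 / r\<^sup>2\<close>, which is attained at some \<open>y\<close> in \<open>(0, 1)\<close>.\<close>

lemma extension_forces_negative_overlap:
  assumes bp: "balanced_profile J P Q" and P0: "cmod (P 0) = r" and ext: "extends_to_plus_one J"
  shows "Re (overlap P Q 0) = 0" "Im (overlap P Q 0) = - r\<^sup>2"
proof -
  have cp: "classical_profile J P Q" and bal: "cmod (P 0) = cmod (Q 0)"
    using bp by (auto simp: balanced_profile_def maximal_profile_def)
  have r: "r > 0"
    using balanced_profile_nonzero[OF bp] P0 by auto
  show X0: "Re (overlap P Q 0) = 0"
    using no_extension_if_Re_overlap_nonzero[OF cp bal] ext by blast
  have "Im (overlap P Q 0) \<noteq> r\<^sup>2"
  proof
    assume Y0: "Im (overlap P Q 0) = r\<^sup>2"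
    define y where "y = (1 / r\<^sup>2) / sqrt (16 + (1 / r\<^sup>2)\<^sup>2)"
    have "clock y = 1 / r\<^sup>2" "y \<in> {-1<..<1}"
      unfolding y_def by (rule clock_eq)+
    moreover have "y \<ge> 0" by (simp add: y_def)
    then have "y \<in> J" using ext \<open>y \<in> {-1<..<1}\<close> by (auto simp: extends_to_plus_one_def)
    ultimately show False
      using Im_overlap_riccati[OF cp bal X0 _ \<open>y \<in> J\<close>] Y0 r by simp
  qed
  then show "Im (overlap P Q 0) = - r\<^sup>2"
    using overlap_at_zero[OF P0 _ X0] bal P0 by auto
qed

lemma extends_to_plus_one_imp_explicit:
  assumes "balanced_profile J P Q" "extends_to_plus_one J" "cmod (P 0) = r"
  shows "equal_up_to_phase J P Q {blowup_point r<..<1} (U_sol r) (V_sol r)"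
  using assms extension_forces_negative_overlap negative_overlap_equal_up_to_phase by blast

lemma extends_to_minus_one_imp_reflected:
  assumes bp: "balanced_profile J P Q" and ext: "extends_to_minus_one J" and P0: "cmod (P 0) = r"
  shows "equal_up_to_phase J P Q (uminus ` {blowup_point r<..<1}) (\<lambda>y. V_sol r (- y)) (\<lambda>y. U_sol r (- y))"
proof -
  have "extends_to_plus_one (uminus ` J)"
    unfolding extends_to_plus_one_def
  proof
    fix y :: real assume "y \<in> {0..<1}"
    then have "- y \<in> J" using ext by (auto simp: extends_to_minus_one_def)
    then show "y \<in> uminus ` J" by (metis image_eqI minus_minus)
  qed
  moreover have "cmod (Q (- 0)) = r"
    using bp P0 by (simp add: balanced_profile_def)
  ultimately have "equal_up_to_phase (uminus ` J) (\<lambda>y. Q (- y)) (\<lambda>y. P (- y))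
      {blowup_point r<..<1} (U_sol r) (V_sol r)"
    by (intro extends_to_plus_one_imp_explicit balanced_profile_reflect[OF bp])
  then obtain \<phi> where J: "uminus ` J = {blowup_point r<..<1}"
    and \<phi>: "\<And>y. y \<in> {blowup_point r<..<1} \<Longrightarrow> Q (- y) = cis \<phi> * U_sol r y \<and> P (- y) = cis \<phi> * V_sol r y"
    unfolding equal_up_to_phase_def by blast
  have "J = uminus ` {blowup_point r<..<1}"
    unfolding J[symmetric] by (simp add: image_image)
  moreover have "P y = cis \<phi> * V_sol r (- y) \<and> Q y = cis \<phi> * U_sol r (- y)"
    if "y \<in> uminus ` {blowup_point r<..<1}" for y
    using \<phi>[of "- y"] that by auto
  ultimately show ?thesis
    unfolding equal_up_to_phase_def by blast
qed

theorem theorem1p2: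
  shows "\<exists>(D :: real \<Rightarrow> real set) (U :: real \<Rightarrow> real \<Rightarrow> complex) (V :: real \<Rightarrow> real \<Rightarrow> complex).
    (\<forall>r>0.
       balanced_profile (D r) (U r) (V r) \<and> cmod (U r 0) = r \<and> extends_to_plus_one (D r) \<and>
       (\<forall>J P Q. balanced_profile J P Q \<and> cmod (P 0) = r \<and> extends_to_plus_one J
          \<longrightarrow> equal_up_to_phase J P Q (D r) (U r) (V r)) \<and>
       (\<exists>c>0. (\<lambda>y. cmod (U r y)) \<sim>[at_left 1] (\<lambda>y. c * (1 - y) powr (1 / 4))) \<and>
       (\<exists>c>0. (\<lambda>y. cmod (V r y)) \<sim>[at_left 1] (\<lambda>y. c * (1 - y) powr (- 1 / 4))) \<and>
       \<not> extends_to_minus_one (D r) \<and>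
       (\<exists>y0\<in>{-1<..<0}. D r = {y0<..<1} \<and>
          filterlim (U r) at_infinity (at_right y0) \<and>
          filterlim (V r) at_infinity (at_right y0))) \<and>
    (\<forall>J P Q. balanced_profile J P Q \<and>
       \<not> (\<exists>r>0. equal_up_to_phase_and_reflection J P Q (D r) (U r) (V r))
       \<longrightarrow> \<not> extends_to_plus_one J \<and> \<not> extends_to_minus_one J)"
proof (rule exI[of _ "\<lambda>r. {blowup_point r<..<1}"], rule exI[of _ U_sol], rule exI[of _ V_sol],
    intro conjI allI impI)
  fix r :: real assume r: "r > 0"
  note s = blowup_point(2)[OF r]
  show "balanced_profile {blowup_point r<..<1} (U_sol r) (V_sol r)"
    by (rule explicit_balanced[OF r])
  show "cmod (U_sol r 0) = r"
    using r by (simp add: explicit_at_zero)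
  show "extends_to_plus_one {blowup_point r<..<1}"
    using s by (auto simp: extends_to_plus_one_def)
  show "equal_up_to_phase J P Q {blowup_point r<..<1} (U_sol r) (V_sol r)"
    if "balanced_profile J P Q \<and> cmod (P 0) = r \<and> extends_to_plus_one J" for J P Q
    using that extends_to_plus_one_imp_explicit by blast
  show "\<exists>c>0. (\<lambda>y. cmod (U_sol r y)) \<sim>[at_left 1] (\<lambda>y. c * (1 - y) powr (1 / 4))"
    "\<exists>c>0. (\<lambda>y. cmod (V_sol r y)) \<sim>[at_left 1] (\<lambda>y. c * (1 - y) powr (- 1 / 4))"
    by (rule explicit_asymptotics[OF r])+
  show "\<not> extends_to_minus_one {blowup_point r<..<1}"
  proof
    assume "extends_to_minus_one {blowup_point r<..<1}"
    moreover have "blowup_point r \<in> {-1<..0}" using s by simp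
    ultimately show False by (auto simp: extends_to_minus_one_def)
  qed
  show "\<exists>y0\<in>{-1<..<0}. {blowup_point r<..<1} = {y0<..<1} \<and>
      filterlim (U_sol r) at_infinity (at_right y0) \<and>
      filterlim (V_sol r) at_infinity (at_right y0)"
    using s explicit_blowup[OF r] by blast
next
  fix J P Q
  assume *: "balanced_profile J P Q \<and>
    \<not> (\<exists>r>0. equal_up_to_phase_and_reflection J P Q {blowup_point r<..<1} (U_sol r) (V_sol r))"
  then have bp: "balanced_profile J P Q" and "cmod (P 0) > 0"
    using balanced_profile_nonzero by auto
  with * have "\<not> equal_up_to_phase_and_reflection J P Q
      {blowup_point (cmod (P 0))<..<1} (U_sol (cmod (P 0))) (V_sol (cmod (P 0)))"
    by blast
  then show "\<not> extends_to_plus_one J" "\<not> extends_to_minus_one J"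
    using extends_to_plus_one_imp_explicit[OF bp _ refl] extends_to_minus_one_imp_reflected[OF bp _ refl]
    unfolding equal_up_to_phase_and_reflection_def by blast+
qed

end
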